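(* Let $P(z)\in\mathbb{C}[z]$, $\deg P=n$, and $a,b\in\mathbb{C}$, $a\neq b$. Let $U$ be a simply connected domain containing no critical values of $P$ such that $P(a),P(b),\infty\in\partial U$ (boundary in $\mathbb{CP}^1$). Fix a canonical numeration of the branches of $P^{-1}(z)$ in $U$. Let $P_{a_1}^{-1},\dots,P_{a_{d_a}}^{-1}$ (resp. $P_{b_1}^{-1},\dots,P_{b_{d_b}}^{-1}$) be the branches of $P^{-1}(z)$ in $U$, numbered by means of this numeration, which map points close to $P(a)$ (resp. $P(b)$) to points close to $a$ (resp. $b$). Put $\varepsilon_n=\exp(2\pi i/n)$ and $$V(a)=\{\varepsilon_n^{a_1},\dots,\varepsilon_n^{a_{d_a}}\},\qquad V(b)=\{\varepsilon_n^{b_1},\dots,\varepsilon_n^{b_{d_b}}\}.$$ Then the sets $V(a)$ and $V(b)$ are almost disjointed. Furthermore, if $P(a)=P(b)$, then $V(a)$ and $V(b)$ are disjointed.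
   Context: Canonical numeration. Let $V\subset U$ be a domain close to infinity, with $\infty\in\partial V$, in which all branches of $P^{-1}$ are given by Puiseux series at infinity and on which a branch of $z^{1/n}$ is fixed. Fix one branch $P_0^{-1}(z)=\sum_{k=-1}^{\infty}v_k z^{-k/n}$ in $V$. The canonical numeration of branches in $V$ is $P_j^{-1}(z)=\sum_{k=-1}^\infty v_k\varepsilon_n^{jk}z^{-k/n}$, $0\le j\le n-1$; it induces a numeration of the branches in $U$ by analytic continuation from $V$ to $U$. It depends on the choice of $P_0^{-1}$, but the induced cyclic ordering of branches does not. Two sets of points $X,Y$ on the unit circle $S_1$ are disjointed if there exist $s_1,s_2\in S_1$ such that all points of $X$ are on one of the two connected components of $S_1\setminus\{s_1,s_2\}$ while all points of $Y$ are on the other one. They are almost disjointed if $X\cap Y$ consists of a single point $s_1$ and there exists a point $s_2\in S_1$ such that all points of $X\setminus\{s_1\}$ are on one of the two connected components of $S_1\setminus\{s_1,s_2\}$ while all points of $Y\setminus\{s_1\}$ are on the other one.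
   Formalization: "Almost disjointed" is replaced by "disjointed or almost disjointed", since almost disjointed requires exactly one common point and V(a), V(b) may have none (e.g. P=z^2, a=1, b=-1, U the upper half-plane). *)

theory Defs
  imports "HOL-Complex_Analysis.Complex_Analysis"
begin

text \<open>
  The Riemann sphere as the one-point compactification of the complex plane:
  \<^term>\<open>None\<close> is the point at infinity and \<^term>\<open>Some z\<close> the finite point \<open>z\<close>.
\<close>

definition riemann_sphere :: "complex option topology" where
  "riemann_sphere = Alexandroff_compactification euclidean"

definition sphere_boundary :: "complex set \<Rightarrow> complex option set" where
  "sphere_boundary U = riemann_sphere frontier_of (Some ` U)"

definition critical_values :: "complex poly \<Rightarrow> complex set" where
  "critical_values P = {poly P z | z. poly (pderiv P) z = 0}"

definition inverse_branch :: "complex poly \<Rightarrow> complex set \<Rightarrow> (complex \<Rightarrow> complex) \<Rightarrow> bool" where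
  "inverse_branch P U f \<longleftrightarrow> f holomorphic_on U \<and> (\<forall>w\<in>U. poly P (f w) = w)"

definition root_of_unity :: "nat \<Rightarrow> complex" where
  "root_of_unity n = exp (2 * of_real pi * \<i> / of_nat n)"

text \<open>
  \<open>f 0, \<dots>, f (n - 1)\<close>, with \<open>n = degree P\<close>, are the branches of the inverse of \<open>P\<close> on \<open>U\<close>
  in a canonical numeration.  The function \<open>\<rho>\<close> is the fixed branch of the \<open>n\<close>-th root on the
  domain \<open>V\<close>, and \<open>v\<close> are the Puiseux coefficients of \<open>f 0\<close>.  Each \<open>f j\<close> is holomorphic on all
  of the connected set \<open>U\<close>, so it is the analytic continuation to \<open>U\<close> of the Puiseux series on
  \<open>V\<close>.  That \<open>V\<close> is close to infinity is expressed by the convergence of the series on \<open>V\<close>: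
  it then converges for all arguments of larger modulus.
\<close>

definition canonical_numeration ::
    "complex poly \<Rightarrow> complex set \<Rightarrow> (nat \<Rightarrow> complex \<Rightarrow> complex) \<Rightarrow> bool" where
  "canonical_numeration P U f \<longleftrightarrow>
     (\<forall>j<degree P. inverse_branch P U (f j)) \<and>
     (\<exists>V \<rho> (v :: int \<Rightarrow> complex).
        open V \<and> connected V \<and> V \<subseteq> U \<and> 0 \<notin> V \<and> None \<in> sphere_boundary V \<and>
        \<rho> holomorphic_on V \<and> (\<forall>z\<in>V. \<rho> z ^ degree P = z) \<and>
        (\<forall>j<degree P. \<forall>z\<in>V.
           ((\<lambda>k. v k * root_of_unity (degree P) powi (int j * k) * \<rho> z powi (- k))
              has_sum f j z) {-1..}))"

text \<open>
  The set \<open>V(c)\<close>.  That a branch maps points close to \<open>P(c)\<close> to points close to \<open>c\<close> means that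
  it tends to \<open>c\<close> at the boundary point \<open>P(c)\<close> of \<open>U\<close>.
\<close>

definition branch_roots ::
    "complex poly \<Rightarrow> complex set \<Rightarrow> (nat \<Rightarrow> complex \<Rightarrow> complex) \<Rightarrow> complex \<Rightarrow> complex set" where
  "branch_roots P U f c =
     {root_of_unity (degree P) ^ j | j.
        j < degree P \<and> (f j \<longlongrightarrow> c) (at (poly P c) within U)}"

text \<open>
  Below, the existence of two different components forces \<open>s1 \<noteq> s2\<close>.  Almost
  disjointed sets have exactly one common point, so disjointed sets are never almost disjointed;
  statements that allow both cases have to say so.
\<close>

definition separated_on_circle ::
    "complex \<Rightarrow> complex \<Rightarrow> complex set \<Rightarrow> complex set \<Rightarrow> bool" where
  "separated_on_circle s1 s2 X Y \<longleftrightarrow>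
     (\<exists>A\<in>components (sphere 0 1 - {s1, s2}). \<exists>B\<in>components (sphere 0 1 - {s1, s2}).
        A \<noteq> B \<and> X \<subseteq> A \<and> Y \<subseteq> B)"

definition circle_disjointed :: "complex set \<Rightarrow> complex set \<Rightarrow> bool" where
  "circle_disjointed X Y \<longleftrightarrow> (\<exists>s1\<in>sphere 0 1. \<exists>s2\<in>sphere 0 1. separated_on_circle s1 s2 X Y)"

definition circle_almost_disjointed :: "complex set \<Rightarrow> complex set \<Rightarrow> bool" where
  "circle_almost_disjointed X Y \<longleftrightarrow>
     (\<exists>s1\<in>sphere 0 1. X \<inter> Y = {s1} \<and>
        (\<exists>s2\<in>sphere 0 1. separated_on_circle s1 s2 (X - {s1}) (Y - {s1})))"

end

theory Submission
  imports Defs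
begin

text \<open>
  Near infinity the branches are \<open>E (\<sigma> + 2 * pi * \<i> * k / n)\<close> for a uniformization \<open>E\<close> of
  \<open>{z. R < norm (P z)}\<close> by a half-plane, so the numeration is the cyclic order of the points \<open>f k q\<close> on
  the boundary of \<open>{z. norm (P z) \<le> R}\<close>, where \<open>R = norm q\<close>.  Lift a continuum \<open>K\<close> joining \<open>P a\<close>, \<open>P b\<close>
  and \<open>q\<close> by the branches: the lifts tending to \<open>a\<close> form a continuum through \<open>a\<close>, those tending to \<open>b\<close>
  a continuum through \<open>b\<close>, and lifts by different branches are disjoint.  By planarity two branches
  tending to \<open>a\<close> cannot be interlaced in the cyclic order with two others tending to \<open>b\<close>.  Moreover at
  most one branch tends to both points, and none if \<open>P a = P b\<close>.  The rest is the combinatorics of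
  non-crossing subsets of a circle.
\<close>

subsection \<open>The Riemann sphere and the unit circle\<close>

text \<open>Lifts are handled as continua rather than curves, so planarity enters through
  Janiszewski's theorem and its dual instead of the Jordan curve theorem. The point \<open>q\<close>
  is chosen as a point of greatest modulus of the part of the continuum inside \<open>U\<close>. All
  lifts then stay in the sublevel set \<open>norm (poly P z) \<le> norm q\<close> and reach its
  boundary at the points \<open>f k q\<close>, whose arguments in the half-plane advance by
  \<open>2 * pi / n\<close> as \<open>k\<close> advances by 1. Interlacing is expressed by strict
  inequalities between integers less than one period apart, so it always involves four different
  residues. A branch common to both points is therefore compatible with non-crossing; it becomes the
  single shared point of almost disjointed sets.\<close>

lemma finite_sphere_boundary:
  assumes "open U" and "Some c \<in> sphere_boundary U"
  shows "c \<in> closure U" and "c \<notin> U"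
proof -
  let ?X = "Alexandroff_compactification (euclidean :: complex topology)"
  have c: "Some c \<in> ?X closure_of (Some ` U)" "Some c \<notin> ?X interior_of (Some ` U)"
    using assms(2) by (auto simp: sphere_boundary_def riemann_sphere_def frontier_of_def)
  show "c \<in> closure U"
    unfolding closure_iff_nhds_not_empty
  proof clarify
    fix A V assume V: "V \<subseteq> A" "open V" "c \<in> V" "U \<inter> A = {}"
    then have "openin ?X (Some ` V)" "Some c \<in> Some ` V" by auto
    with c(1) have "\<exists>y\<in>Some ` U. y \<in> Some ` V" unfolding in_closure_of by blast
    with V show False by auto
  qed
  have "?X interior_of (Some ` U) = Some ` U"
    using assms(1) by (simp add: interior_of_openin)
  with c(2) show "c \<notin> U" by auto
qed

lemma infinite_sphere_boundary:
  assumes "None \<in> sphere_boundary V"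
  shows "\<not> bounded V"
proof
  let ?X = "Alexandroff_compactification (euclidean :: complex topology)"
  assume "bounded V"
  then obtain r where r: "V \<subseteq> cball 0 r" using bounded_subset_ballD[of V 0] ball_subset_cball by (metis subset_trans)
  have "openin ?X (insert None (Some ` (topspace euclidean - cball 0 r)))"
    unfolding openin_Alexandroff_compactification by (intro disjI2 exI[of _ "cball 0 r"]) auto
  moreover have "None \<in> ?X closure_of (Some ` V)"
    using assms by (auto simp: sphere_boundary_def riemann_sphere_def frontier_of_def)
  ultimately have "\<exists>y\<in>Some ` V. y \<in> insert None (Some ` (topspace euclidean - cball 0 r))"
    unfolding in_closure_of by (meson insertI1)
  then show False using r by auto
qed

section \<open>Arcs of the unit circle as components\<close>

lemma connected_avoiding_line:
  fixes C :: "complex set"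
  assumes "connected C" "\<And>z. z \<in> C \<Longrightarrow> inner m z \<noteq> c" "x \<in> C" "y \<in> C" "c < inner m x"
  shows "c < inner m y"
proof (rule ccontr)
  assume "\<not> c < inner m y"
  then have "\<exists>z\<in>C. inner m z = c"
    using connected_ivt_hyperplane[of C y x m c] assms by auto
  then show False using assms(2) by blast
qed

lemma inner_cis: "inner (cis m) (cis t) = cos (t - m)"
  by (simp add: inner_complex_def cos_diff mult.commute)

lemma connected_cis_image:
  "connected (cis ` {a<..<b::real})"
  by (intro connected_continuous_image continuous_intros) auto

lemma cis_cover:
  assumes "norm z = 1"
  obtains t where "\<alpha> \<le> t" "t < \<alpha> + 2 * pi" "z = cis t"
proof -
  define k where "k = \<lceil>(\<alpha> - Arg z) / (2 * pi)\<rceil>"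
  have z: "z = cis (Arg z)" using assms
    by (metis cis_Arg norm_zero zero_neq_one sgn_div_norm inverse_1 scale_one)
  have "cis (Arg z + 2 * pi * of_int k) = cis (Arg z)"
    by (simp add: complex_eq_iff cos_add sin_add cos_int_2pin sin_int_2pin)
  moreover have "of_int k \<ge> (\<alpha> - Arg z) / (2 * pi)" "of_int k < (\<alpha> - Arg z) / (2 * pi) + 1"
    unfolding k_def by linarith+
  then have "of_int k * (2 * pi) \<ge> \<alpha> - Arg z" "of_int k * (2 * pi) < \<alpha> - Arg z + 2 * pi"
    using pi_gt_zero by (simp_all add: field_simps)
  ultimately show ?thesis using z that[of "Arg z + 2 * pi * of_int k"] by (auto simp: mult.commute)
qed

lemma cos_less_far:
  assumes "h < u" "u < 2 * pi - h" "0 < h" "h < pi"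
  shows "cos u < cos h"
proof (cases "u \<le> pi")
  case True
  then show ?thesis using assms by (intro cos_monotone_0_pi) auto
next
  case False
  then have "cos (2 * pi - u) < cos h" using assms by (intro cos_monotone_0_pi) auto
  then show ?thesis by (simp add: cos_diff)
qed

text \<open>The chord line through the two cut points is \<open>inner m z = cos h\<close>, with
  \<open>m\<close> the midpoint of the first arc and \<open>h\<close> half its angular length. The
  two arcs lie strictly on different sides of it, and a connected subset of \<open>S\<close> cannot
  cross it; this makes each arc maximal.\<close>

lemma circle_arc_components:
  assumes "\<alpha> < \<beta>" "\<beta> < \<alpha> + 2 * pi"
  defines "S \<equiv> sphere 0 1 - {cis \<alpha>, cis \<beta>}"
  shows "cis ` {\<alpha><..<\<beta>} \<in> components S" "cis ` {\<beta><..<\<alpha> + 2 * pi} \<in> components S"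
    "cis ` {\<alpha><..<\<beta>} \<noteq> cis ` {\<beta><..<\<alpha> + 2 * pi}"
proof -
  define A B where "A = cis ` {\<alpha><..<\<beta>}" and "B = cis ` {\<beta><..<\<alpha> + 2 * pi}"
  define m h where "m = cis ((\<alpha> + \<beta>) / 2)" and "h = (\<beta> - \<alpha>) / 2"
  have h: "0 < h" "h < pi" using assms by (auto simp: h_def)
  have inA: "cos h < inner m z" if z: "z \<in> A" for z
  proof -
    obtain t where t: "\<alpha> < t" "t < \<beta>" "z = cis t" using z by (auto simp: A_def)
    have "cos h < cos \<bar>t - (\<alpha> + \<beta>) / 2\<bar>"
      using t h by (intro cos_monotone_0_pi) (auto simp: h_def abs_if field_simps)
    then show ?thesis using t by (simp add: m_def inner_cis)
  qed
  have inB: "inner m z < cos h" if z: "z \<in> B" for z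
  proof -
    obtain t where t: "\<beta> < t" "t < \<alpha> + 2 * pi" "z = cis t" using z by (auto simp: B_def)
    have "cos (t - (\<alpha> + \<beta>) / 2) < cos h"
      using t h by (intro cos_less_far) (auto simp: h_def field_simps)
    then show ?thesis using t by (simp add: m_def inner_cis)
  qed
  have ends: "inner m (cis \<alpha>) = cos h" "inner m (cis \<beta>) = cos h"
  proof -
    have "\<alpha> - (\<alpha> + \<beta>) / 2 = - h" "\<beta> - (\<alpha> + \<beta>) / 2 = h" by (simp_all add: h_def field_simps)
    then show "inner m (cis \<alpha>) = cos h" "inner m (cis \<beta>) = cos h"
      unfolding m_def inner_cis by simp_all
  qed
  have S: "S = A \<union> B"
  proof
    show "A \<union> B \<subseteq> S"
      using inA inB ends unfolding S_def by (fastforce simp: A_def B_def)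
    show "S \<subseteq> A \<union> B"
    proof
      fix z assume z: "z \<in> S"
      then obtain t where "\<alpha> \<le> t" "t < \<alpha> + 2 * pi" "z = cis t"
        using cis_cover[of z \<alpha>] by (auto simp: S_def)
      then show "z \<in> A \<union> B" using z
        by (cases "t = \<alpha>"; cases "t = \<beta>"; cases "t < \<beta>") (auto simp: S_def A_def B_def)
    qed
  qed
  have con: "connected A" "connected B"
    unfolding A_def B_def by (rule connected_cis_image)+
  have ne: "A \<noteq> {}" "B \<noteq> {}" using assms by (auto simp: A_def B_def)
  have off: "inner m z \<noteq> cos h" if "z \<in> S" for z using that inA inB unfolding S by fastforce
  have maxA: "C \<subseteq> A" if C: "connected C" "C \<subseteq> S" "C \<inter> A \<noteq> {}" for C
  proof
    fix y assume "y \<in> C"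
    obtain x where "x \<in> C" "x \<in> A" using C by auto
    then have "cos h < inner m y"
      using connected_avoiding_line[OF C(1), of m "cos h" x y] off C \<open>y \<in> C\<close> inA by blast
    then show "y \<in> A" using inB \<open>y \<in> C\<close> C S by fastforce
  qed
  have maxB: "C \<subseteq> B" if C: "connected C" "C \<subseteq> S" "C \<inter> B \<noteq> {}" for C
  proof
    fix y assume "y \<in> C"
    obtain x where "x \<in> C" "x \<in> B" using C by auto
    then have "- cos h < inner (- m) y"
      using connected_avoiding_line[OF C(1), of "- m" "- cos h" x y] off C \<open>y \<in> C\<close> inB by auto
    then show "y \<in> B" using inA \<open>y \<in> C\<close> C S by fastforce
  qed
  have "D = A" if "A \<subseteq> D" "D \<subseteq> S" "connected D" for D using maxA[of D] that ne by blast
  moreover have "D = B" if "B \<subseteq> D" "D \<subseteq> S" "connected D" for D using maxB[of D] that ne by blast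
  ultimately have "A \<in> components S" "B \<in> components S"
    unfolding in_components_maximal using con ne S by simp_all
  moreover have "A \<noteq> B" using ne inA inB by (metis all_not_in_conv order_less_asym)
  ultimately show "cis ` {\<alpha><..<\<beta>} \<in> components S" "cis ` {\<beta><..<\<alpha> + 2 * pi} \<in> components S"
    "cis ` {\<alpha><..<\<beta>} \<noteq> cis ` {\<beta><..<\<alpha> + 2 * pi}" by (simp_all add: A_def B_def)
qed

text \<open>The parameter counts steps of one \<open>n\<close>-th of a turn: integers give the roots
  of unity, and real values leave room for cut points between neighbouring roots.\<close>

definition circle_point :: "nat \<Rightarrow> real \<Rightarrow> complex" where
  "circle_point n x = cis (2 * pi * x / n)"

lemma circle_point_in_sphere [simp]: "circle_point n x \<in> sphere 0 1"
  by (simp add: circle_point_def)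

lemma circle_point_int_mod:
  assumes "n > 0" shows "circle_point n (of_int (k mod int n)) = circle_point n (of_int k)"
proof -
  define q where "q = k div int n"
  have "real_of_int k = real_of_int (k mod int n + int n * q)" by (simp add: q_def)
  then have "2 * pi * real_of_int k / n = 2 * pi * real_of_int (k mod int n) / n + 2 * pi * q"
    using assms by (simp add: field_simps)
  then show ?thesis
    by (simp add: circle_point_def complex_eq_iff cos_add sin_add cos_int_2pin sin_int_2pin)
qed

lemma separated_on_circleI:
  assumes "n > 0" "x1 < x2" "x2 < x1 + n"
    and "X \<subseteq> circle_point n ` {x1<..<x2}" "Y \<subseteq> circle_point n ` {x2<..<x1 + n}"
  shows "separated_on_circle (circle_point n x1) (circle_point n x2) X Y"
proof -
  let ?a = "2 * pi * x1 / n" and ?b = "2 * pi * x2 / n"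
  have ab: "?a < ?b" "?b < ?a + 2 * pi"
    using mult_strict_left_mono[OF assms(3), of "2 * pi"] assms(1,2) by (auto simp: field_simps)
  have sub: "circle_point n ` {u<..<v} \<subseteq> cis ` {2 * pi * u / n<..<2 * pi * v / n}" for u v
    using assms(1) by (auto simp: circle_point_def divide_strict_right_mono)
  have "2 * pi * (x1 + n) / n = ?a + 2 * pi" using assms(1) by (simp add: field_simps)
  then have "X \<subseteq> cis ` {?a<..<?b}" "Y \<subseteq> cis ` {?b<..<?a + 2 * pi}"
    using assms(4,5) sub[of x1 x2] sub[of x2 "x1 + n"] by auto
  then show ?thesis
    using circle_arc_components[OF ab]
    unfolding separated_on_circle_def circle_point_def by (intro bexI conjI)
qed

lemma separated_on_circle_sym:
  "separated_on_circle s1 s2 X Y \<Longrightarrow> separated_on_circle s1 s2 Y X"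
  unfolding separated_on_circle_def by blast

subsection \<open>Non-crossing sets of residues\<close>

lemma circle_point_eq_imp_mod_eq:
  assumes "n > 0" "circle_point n (of_int k) = circle_point n (of_int l)"
  shows "k mod int n = l mod int n"
proof -
  obtain q :: int where "2 * pi * k / n = 2 * pi * l / n + 2 * pi * q"
    using assms(2) sin_cos_eq_iff[of "2 * pi * k / n" "2 * pi * l / n"]
    by (auto simp: circle_point_def complex_eq_iff)
  then have "2 * pi * k = 2 * pi * (l + n * q)" using assms(1) by (simp add: field_simps)
  then have "real_of_int k = real_of_int (l + int n * q)" by simp
  then have "k = l + int n * q" using of_int_eq_iff by blast
  then show ?thesis by simp
qed

text \<open>Sets of residues are kept as periodic predicates on the integers, so that an arc passing
  through residue 0 is still an ordinary interval.\<close>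

definition mod_periodic :: "nat \<Rightarrow> (int \<Rightarrow> bool) \<Rightarrow> bool" where
  "mod_periodic n A \<longleftrightarrow> (\<forall>k. A (k mod int n) = A k)"

lemma mod_periodicD: "mod_periodic n A \<Longrightarrow> A (k mod int n) = A k"
  by (simp add: mod_periodic_def)

text \<open>Every residue has a representative in the period starting at \<open>l\<close>, so
  containment in an arc need only be checked there. \<open>Z\<close> allows a common point to be
  left out.\<close>

lemma circle_point_image_window:
  fixes l :: int
  assumes n: "n > 0" and per: "mod_periodic n A"
    and win: "\<And>k. l \<le> k \<Longrightarrow> k < l + int n \<Longrightarrow> A k \<Longrightarrow> circle_point n (of_int k) \<notin> Z
                \<Longrightarrow> x < of_int k \<and> of_int k < y"
  shows "circle_point n ` of_int ` {k. A k} - Z \<subseteq> circle_point n ` {x<..<y}"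
proof clarify
  fix k assume k: "A k" "circle_point n (real_of_int k) \<notin> Z"
  define k' where "k' = (k - l) mod int n + l"
  have m: "k' mod int n = k mod int n" by (simp add: k'_def mod_add_left_eq)
  have "circle_point n k' = circle_point n k" "A k'"
    using m k mod_periodicD[OF per, of k] mod_periodicD[OF per, of k'] circle_point_int_mod[OF n, of k] circle_point_int_mod[OF n, of k']
    by simp_all
  moreover have "l \<le> k'" "k' < l + int n" using n by (auto simp: k'_def)
  ultimately show "circle_point n k \<in> circle_point n ` {x<..<y}"
    using win[of k'] k by (metis greaterThanLessThan_iff imageI)
qed

text \<open>The bound \<open>j2 < i1 + int n\<close> keeps the four indices within one turn, so
  their linear order is their cyclic order. Common residues of \<open>A\<close> and \<open>B\<close>
  are not excluded.\<close>

definition noncrossing :: "nat \<Rightarrow> (int \<Rightarrow> bool) \<Rightarrow> (int \<Rightarrow> bool) \<Rightarrow> bool" where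
  "noncrossing n A B \<longleftrightarrow> (\<forall>i1 j1 i2 j2. A i1 \<and> B j1 \<and> A i2 \<and> B j2 \<longrightarrow>
     \<not> (i1 < j1 \<and> j1 < i2 \<and> i2 < j2 \<and> j2 < i1 + int n))"

lemma noncrossingD:
  "noncrossing n A B \<Longrightarrow> A i1 \<Longrightarrow> B j1 \<Longrightarrow> A i2 \<Longrightarrow> B j2 \<Longrightarrow>
   i1 < j1 \<Longrightarrow> j1 < i2 \<Longrightarrow> i2 < j2 \<Longrightarrow> j2 < i1 + int n \<Longrightarrow> False"
  unfolding noncrossing_def by blast

text \<open>Moving the first index to the end by one period turns an interlacing that begins in
  \<open>B\<close> into one that begins in \<open>A\<close>.\<close>

lemma noncrossing_sym:
  assumes "noncrossing n A B" "mod_periodic n B"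
  shows "noncrossing n B A"
  unfolding noncrossing_def
proof safe
  fix j1 i1 j2 i2
  assume *: "B j1" "A i1" "B j2" "A i2" "j1 < i1" "i1 < j2" "j2 < i2" "i2 < j1 + int n"
  have "B (j1 + int n)" using *(1) mod_periodicD[OF assms(2), of j1] mod_periodicD[OF assms(2), of "j1 + int n"] by simp
  then show False using noncrossingD[OF assms(1), of i1 j2 i2 "j1 + int n"] * by simp
qed

lemma circle_disjointed_sym: "circle_disjointed X Y \<Longrightarrow> circle_disjointed Y X"
  unfolding circle_disjointed_def using separated_on_circle_sym by blast

lemma circle_disjointedI_hull:
  assumes n: "n > 0"
    and per: "mod_periodic n A" "mod_periodic n B"
    and j: "0 \<le> j1" "j1 \<le> j2" "j2 < int n"
    and B: "\<And>k. 0 \<le> k \<Longrightarrow> k < int n \<Longrightarrow> B k \<Longrightarrow> j1 \<le> k \<and> k \<le> j2"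
    and A: "\<And>k. j1 \<le> k \<Longrightarrow> k \<le> j2 \<Longrightarrow> \<not> A k"
  shows "circle_disjointed (circle_point n ` of_int ` {k. A k}) (circle_point n ` of_int ` {k. B k})"
proof -
  \<comment> \<open>Cuts a quarter of a step outside the interval stay distinct even if it fills a
    whole period, the case used for an empty \<open>A\<close>; half steps would then give the same
    point twice.\<close>
  have "separated_on_circle (circle_point n (j1 - 1/4)) (circle_point n (j2 + 1/4))
     (circle_point n ` of_int ` {k. B k} - {}) (circle_point n ` of_int ` {k. A k} - {})"
  proof (rule separated_on_circleI[OF n])
    show "circle_point n ` of_int ` {k. B k} - {} \<subseteq> circle_point n ` {of_int j1 - 1/4<..<of_int j2 + 1/4}"
      using B by (intro circle_point_image_window[OF n per(2), of 0]) force
    show "circle_point n ` of_int ` {k. A k} - {} \<subseteq>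
      circle_point n ` {of_int j2 + 1/4<..<of_int j1 - 1/4 + real n}"
    proof (intro circle_point_image_window[OF n per(1), of j1])
      fix k assume "j1 \<le> k" "k < j1 + int n" "A k"
      then have "j2 < k" using A[of k] by (meson not_le)
      with \<open>k < j1 + int n\<close> have "j2 + 1 \<le> k" "k + 1 \<le> j1 + int n" by auto
      then have "real_of_int (j2 + 1) \<le> of_int k" "real_of_int (k + 1) \<le> of_int (j1 + int n)"
        by linarith+
      then show "of_int j2 + 1/4 < real_of_int k \<and> real_of_int k < of_int j1 - 1/4 + real n" by simp
    qed
  qed (use j in linarith)+
  then show ?thesis
    unfolding circle_disjointed_def using separated_on_circle_sym circle_point_in_sphere
    by (metis Diff_empty)
qed

text \<open>Take the hulls of both sets within one period. If each set entered the hull of the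
  other, the endpoints of one hull together with an intruder and the smaller endpoint of the other
  would interlace. So one hull is free of the other set and can be cut out.\<close>

lemma noncrossing_imp_circle_disjointed:
  assumes n: "n > 0"
    and per: "mod_periodic n A" "mod_periodic n B"
    and nc: "noncrossing n A B" and dj: "\<And>k. \<not> (A k \<and> B k)"
  shows "circle_disjointed (circle_point n ` of_int ` {k. A k}) (circle_point n ` of_int ` {k. B k})"
proof -
  have hull: "circle_disjointed (circle_point n ` of_int ` {k. A k}) (circle_point n ` of_int ` {k. B k})"
    if per: "mod_periodic n A" "mod_periodic n B" and no: "\<And>k. \<not> A k"
    for A B
    by (rule circle_disjointedI_hull[OF n per, of 0 "int n - 1"]) (use no n in auto)
  show ?thesis
  proof (cases "(\<exists>k. A k) \<and> (\<exists>k. B k)")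
    case False
    then show ?thesis using hull[OF per] hull[OF per(2,1)] circle_disjointed_sym by blast
  next
    case True
    define I J where "I = {k\<in>{0..<int n}. A k}" and "J = {k\<in>{0..<int n}. B k}"
    have fin: "finite I" "finite J" unfolding I_def J_def by (intro finite_Collect_conjI; simp)+
    obtain i j where "A i" "B j" using True by blast
    then have "i mod int n \<in> I" "j mod int n \<in> J" using per n by (auto simp: I_def J_def mod_periodicD)
    then have ne: "I \<noteq> {}" "J \<noteq> {}" by auto
    define i1 i2 j1 j2 where "i1 = Min I" and "i2 = Max I" and "j1 = Min J" and "j2 = Max J"
    have mem: "i1 \<in> I" "i2 \<in> I" "j1 \<in> J" "j2 \<in> J"
      using fin ne by (auto simp: i1_def i2_def j1_def j2_def)
    have bd: "k \<in> I \<Longrightarrow> i1 \<le> k \<and> k \<le> i2" "k \<in> J \<Longrightarrow> j1 \<le> k \<and> k \<le> j2" for k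
      using fin by (auto simp: i1_def i2_def j1_def j2_def)
    have or: "(\<forall>k. j1 \<le> k \<and> k \<le> j2 \<longrightarrow> \<not> A k) \<or> (\<forall>k. i1 \<le> k \<and> k \<le> i2 \<longrightarrow> \<not> B k)"
    proof (rule ccontr)
      assume "\<not> ?thesis"
      then obtain k l where kl: "j1 \<le> k" "k \<le> j2" "A k" "i1 \<le> l" "l \<le> i2" "B l" by blast
      have m: "A i1" "A i2" "B j1" "B j2" "0 \<le> i1" "0 \<le> j1" "i2 < int n" "j2 < int n"
        using mem by (auto simp: I_def J_def)
      have neq: "x \<noteq> y" if "A x" "B y" for x y using dj that by blast
      have s: "j1 < k" "k < j2" "i1 < l" "l < i2"
        using kl neq[OF kl(3) m(3)] neq[OF kl(3) m(4)] neq[OF m(1) kl(6)] neq[OF m(2) kl(6)] by auto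
      consider "i1 < j1" | "j1 < i1" using neq[OF m(1) m(3)] by linarith
      then show False
      proof cases
        case 1
        then show ?thesis using noncrossingD[OF nc m(1) m(3) kl(3) m(4)] s m by linarith
      next
        case 2
        then show ?thesis
          using noncrossingD[OF noncrossing_sym[OF nc per(2)] m(3) m(1) kl(6) m(2)] s m by linarith
      qed
    qed
    from or show ?thesis
    proof
      assume *: "\<forall>k. j1 \<le> k \<and> k \<le> j2 \<longrightarrow> \<not> A k"
      show ?thesis
        by (rule circle_disjointedI_hull[OF n per, of j1 j2]) (use * mem bd in \<open>auto simp: I_def J_def\<close>)
    next
      assume *: "\<forall>k. i1 \<le> k \<and> k \<le> i2 \<longrightarrow> \<not> B k"
      show ?thesis
        by (rule circle_disjointed_sym, rule circle_disjointedI_hull[OF n per(2,1), of i1 i2])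
          (use * mem bd in \<open>auto simp: I_def J_def\<close>)
    qed
  qed
qed

text \<open>Cutting the circle at the common point \<open>s\<close> makes the order linear. An
  interlacing that uses \<open>s\<close> itself is impossible, which leaves all remaining points of
  one set before all those of the other.\<close>

lemma noncrossing_imp_circle_almost_disjointed:
  assumes n: "n > 0"
    and per: "mod_periodic n A" "mod_periodic n B"
    and nc: "noncrossing n A B" and s: "A s" "B s"
    and un: "\<And>k. A k \<Longrightarrow> B k \<Longrightarrow> k mod int n = s mod int n"
  shows "circle_almost_disjointed (circle_point n ` of_int ` {k. A k}) (circle_point n ` of_int ` {k. B k})"
proof -
  let ?X = "circle_point n ` of_int ` {k. A k}" and ?Y = "circle_point n ` of_int ` {k. B k}"
  let ?s = "circle_point n (of_int s)"
  have eq: "circle_point n (of_int k) = circle_point n (of_int l) \<longleftrightarrow> k mod int n = l mod int n" for k l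
    using circle_point_eq_imp_mod_eq[OF n] circle_point_int_mod[OF n] by metis
  have int: "?X \<inter> ?Y = {?s}"
  proof
    show "?X \<inter> ?Y \<subseteq> {?s}"
    proof
      fix z assume "z \<in> ?X \<inter> ?Y"
      then obtain k l where kl: "A k" "B l" "z = circle_point n (of_int k)" "z = circle_point n (of_int l)"
        by blast
      then have "B k" using mod_periodicD[OF per(2), of k] mod_periodicD[OF per(2), of l] eq by metis
      then show "z \<in> {?s}" using un kl eq by blast
    qed
  qed (use s in blast)
  \<comment> \<open>The common point one period later closes the window and belongs to both sets, so
    it can be the fourth index of an interlacing of either kind.\<close>
  have sn: "A (s + int n)" "B (s + int n)"
    using s mod_periodicD[OF per(1), of s] mod_periodicD[OF per(1), of "s + int n"] mod_periodicD[OF per(2), of s] mod_periodicD[OF per(2), of "s + int n"] by simp_all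
  define I J where "I = {k\<in>{s<..<s + int n}. A k}" and "J = {k\<in>{s<..<s + int n}. B k}"
  have fin: "finite I" "finite J" unfolding I_def J_def by (intro finite_Collect_conjI; simp)+
  \<comment> \<open>The second cut lies half a step after an index \<open>c\<close> that bounds the
    first block. The value \<open>c = s\<close> is allowed and serves when a block is empty.\<close>
  have sep: "separated_on_circle ?s (circle_point n (of_int c + 1/2))
      (circle_point n ` of_int ` {k. A k} - {?s}) (circle_point n ` of_int ` {k. B k} - {?s})"
    if c: "s \<le> c" "c < s + int n" "\<And>k. k \<in> I \<Longrightarrow> k \<le> c" "\<And>k. k \<in> J \<Longrightarrow> c < k"
      and per: "mod_periodic n A" "mod_periodic n B"
      and IJ: "I = {k\<in>{s<..<s + int n}. A k}" "J = {k\<in>{s<..<s + int n}. B k}"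
    for c A B I J
  proof (rule separated_on_circleI[OF n])
    let ?X = "circle_point n ` of_int ` {k. A k}" and ?Y = "circle_point n ` of_int ` {k. B k}"
    show "?X - {?s} \<subseteq> circle_point n ` {of_int s<..<of_int c + 1/2}"
    proof (rule circle_point_image_window[OF n per(1), of s])
      fix k assume "s \<le> k" "k < s + int n" "A k" "circle_point n (of_int k) \<notin> {?s}"
      then have "k \<in> I" "s < k" using eq[of k s] by (auto simp: IJ order_less_le)
      then show "of_int s < real_of_int k \<and> of_int k < real_of_int c + 1/2" using c(3) by force
    qed
    show "?Y - {?s} \<subseteq> circle_point n ` {of_int c + 1/2<..<of_int s + real n}"
    proof (rule circle_point_image_window[OF n per(2), of s])
      fix k assume *: "s \<le> k" "k < s + int n" "B k" "circle_point n (of_int k) \<notin> {?s}"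
      then have "k \<in> J" using eq[of k s] by (auto simp: IJ order_less_le)
      then have "c + 1 \<le> k" using c(4) by force
      then have "real_of_int (c + 1) \<le> of_int k" "real_of_int k < of_int (s + int n)"
        using * by linarith+
      then show "real_of_int c + 1/2 < of_int k \<and> real_of_int k < of_int s + real n" by simp
    qed
  qed (use c(1,2) in linarith)+
  have "\<exists>s2\<in>sphere 0 1. separated_on_circle ?s s2 (?X - {?s}) (?Y - {?s})"
  proof -
    have "(\<exists>c. s \<le> c \<and> c < s + int n \<and> (\<forall>k\<in>I. k \<le> c) \<and> (\<forall>k\<in>J. c < k)) \<or>
          (\<exists>c. s \<le> c \<and> c < s + int n \<and> (\<forall>k\<in>J. k \<le> c) \<and> (\<forall>k\<in>I. c < k))"
    proof (cases "I = {} \<or> J = {}")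
      case True
      have "\<forall>k\<in>I. s < k" "\<forall>k\<in>J. s < k" by (auto simp: I_def J_def)
      then show ?thesis using True n
        by (elim disjE) (auto intro!: exI[of _ s])
    next
      case False
      define i1 i2 j1 j2 where "i1 = Min I" and "i2 = Max I" and "j1 = Min J" and "j2 = Max J"
      have mem: "i1 \<in> I" "i2 \<in> I" "j1 \<in> J" "j2 \<in> J"
        using fin False by (auto simp: i1_def i2_def j1_def j2_def)
      have bd: "k \<in> I \<Longrightarrow> i1 \<le> k \<and> k \<le> i2" "k \<in> J \<Longrightarrow> j1 \<le> k \<and> k \<le> j2" for k
        using fin by (auto simp: i1_def i2_def j1_def j2_def)
      have m: "A i1" "A i2" "B j1" "B j2" "s < i1" "s < j1" "i2 < s + int n" "j2 < s + int n"
        using mem by (auto simp: I_def J_def)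
      have "I \<inter> J = {}"
      proof (rule ccontr)
        assume "I \<inter> J \<noteq> {}"
        then obtain k where k: "A k" "B k" "s < k" "k < s + int n" by (auto simp: I_def J_def)
        then have "(k - s) mod int n = 0" using un[of k] mod_eq_dvd_iff by (metis dvd_imp_mod_0)
        then show False using k by simp
      qed
      then have neq: "x \<noteq> y" if "x \<in> I" "y \<in> J" for x y using that by blast
      have "i2 < j1 \<or> j2 < i1"
      proof (rule ccontr)
        assume "\<not> ?thesis"
        then have c: "j1 < i2" "i1 < j2" using neq mem by force+
        consider "i1 < j1" | "j1 < i1" using neq[OF mem(1) mem(3)] by linarith
        then show False
        proof cases
          case 1
          then show ?thesis using noncrossingD[OF nc m(1) m(3) m(2) sn(2)] c m by linarith
        next
          case 2
          then show ?thesis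
            using noncrossingD[OF noncrossing_sym[OF nc per(2)] m(3) m(1) m(4) sn(1)] c m by linarith
        qed
      qed
      then show ?thesis
      proof
        assume "i2 < j1"
        then show ?thesis using bd m(7) bd(1)[OF mem(1)] m(5) by (intro disjI1 exI[of _ i2]) force
      next
        assume "j2 < i1"
        then show ?thesis using bd m(8) bd(2)[OF mem(3)] m(6) by (intro disjI2 exI[of _ j2]) force
      qed
    qed
    then show ?thesis
    proof (elim disjE exE conjE)
      fix c assume "s \<le> c" "c < s + int n" "\<forall>k\<in>I. k \<le> c" "\<forall>k\<in>J. c < k"
      then show ?thesis using sep[OF _ _ _ _ per I_def J_def, of c] circle_point_in_sphere by blast
    next
      fix c assume "s \<le> c" "c < s + int n" "\<forall>k\<in>J. k \<le> c" "\<forall>k\<in>I. c < k"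
      then show ?thesis
        using sep[OF _ _ _ _ per(2,1) J_def I_def, of c] circle_point_in_sphere separated_on_circle_sym
        by blast
    qed
  qed
  then show ?thesis unfolding circle_almost_disjointed_def using int circle_point_in_sphere by blast
qed

subsection \<open>Separation in the plane\<close>

lemma exp_representative:
  obtains t where "Re t = Re s" "\<alpha> \<le> Im t" "Im t < \<alpha> + 2 * pi" "exp t = exp s"
proof -
  obtain u where "\<alpha> \<le> u" "u < \<alpha> + 2 * pi" "cis (Im s) = cis u"
    using cis_cover[of "cis (Im s)" \<alpha>] by auto
  then show ?thesis using that[of "Complex (Re s) u"] by (simp add: exp_eq_polar)
qed

text \<open>
  In the coordinate \<open>exp s\<close> the complement of \<open>T\<close> is a punctured disc, whose puncture is the point at
  infinity.  A chord of this disc joining the two ends of \<open>A\<close> is chosen so as to go round the puncture;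
  Janiszewski's theorem, applied to \<open>A\<close> with the chord and to \<open>T\<close>, shows that \<open>A\<close> with the chord
  separates the two ends of \<open>B\<close>.
\<close>
lemma no_crossing_continua:
  fixes E :: "complex \<Rightarrow> complex"
  assumes hol: "E holomorphic_on {s. Re s < c1}" and c: "c0 < c1"
    and inj: "\<And>s t. Re s < c1 \<Longrightarrow> Re t < c1 \<Longrightarrow> E s = E t \<longleftrightarrow> exp s = exp t"
    and T: "closed T" "- T = E ` {s. Re s < c0}"
    and A: "compact A" "connected A" "A \<subseteq> T" and B: "connected B" "B \<subseteq> T"
    and AB: "A \<inter> B = {}"
    and ends: "E (Complex c0 \<alpha>1) \<in> A" "E (Complex c0 \<alpha>2) \<in> A"
      "E (Complex c0 \<beta>1) \<in> B" "E (Complex c0 \<beta>2) \<in> B"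
    and ord: "\<alpha>1 < \<beta>1" "\<beta>1 < \<alpha>2" "\<alpha>2 < \<beta>2" "\<beta>2 < \<alpha>1 + 2 * pi"
  shows False
proof -
  \<comment> \<open>Smaller real part means closer to infinity. The chord \<open>L\<close> descends
    to depth 1, while the probes \<open>M\<close> attached to the ends of \<open>B\<close> only
    reach depth 1/2. The probe at \<open>\<beta>1\<close> thus stops before the chord, and the one
    at \<open>\<beta>2\<close> lies outside its range of arguments.\<close>
  define L where "L = cbox (Complex (c0 - 1) \<alpha>1) (Complex c0 \<alpha>1) \<union>
    cbox (Complex (c0 - 1) \<alpha>1) (Complex (c0 - 1) \<alpha>2) \<union> cbox (Complex (c0 - 1) \<alpha>2) (Complex c0 \<alpha>2)"
  define M where "M \<beta> = cbox (Complex (c0 - 1/2) \<beta>) (Complex c0 \<beta>)" for \<beta>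
  \<comment> \<open>\<open>W1\<close> and \<open>W2\<close> are the two sides of the chord,
    \<open>W2\<close> being the one that contains a neighbourhood of infinity. They are disjoint
    because \<open>E\<close> determines the real part, and also the imaginary part within a range
    shorter than \<open>2 * pi\<close>.\<close>
  define W1 where "W1 = E ` box (Complex (c0 - 1) \<alpha>1) (Complex c0 \<alpha>2)"
  define W2 where "W2 = E ` ({s. Re s < c0 - 1} \<union> {s. Re s < c0 \<and> \<alpha>2 < Im s \<and> Im s < \<alpha>1 + 2 * pi})"
  define S x y where "S = A \<union> E ` L" and "x = E (Complex (c0 - 1/2) \<beta>1)" and "y = E (Complex (c0 - 1/2) \<beta>2)"
  have L: "s \<in> L \<longleftrightarrow> c0 - 1 \<le> Re s \<and> Re s \<le> c0 \<and> (Im s = \<alpha>1 \<or> Im s = \<alpha>2) \<or>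
      Re s = c0 - 1 \<and> \<alpha>1 \<le> Im s \<and> Im s \<le> \<alpha>2" for s
    unfolding L_def using ord by (auto simp: in_cbox_complex_iff)
  have M: "s \<in> M \<beta> \<longleftrightarrow> c0 - 1/2 \<le> Re s \<and> Re s \<le> c0 \<and> Im s = \<beta>" for s \<beta>
    unfolding M_def by (auto simp: in_cbox_complex_iff)
  have cont: "continuous_on X E" if "X \<subseteq> {s. Re s \<le> c0}" for X
    using holomorphic_on_imp_continuous_on[OF hol] by (rule continuous_on_subset) (use that c in force)
  have out: "E s \<notin> T" if "Re s < c0" for s using T(2) that by blast
  have re: "Re s = Re t" if "E s = E t" "Re s \<le> c0" "Re t \<le> c0" for s t
  proof -
    have "exp s = exp t" using that inj[of s t] c by simp
    then show ?thesis by (metis norm_exp_eq_Re exp_inj_iff)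
  qed
  have same: "s = t" if "E s = E t" "Re s \<le> c0" "Re t \<le> c0" "\<bar>Im s - Im t\<bar> < 2 * pi" for s t
    using that inj[of s t] c exp_complex_eqI[of s t] by simp
  have LT: "E ` L \<inter> T \<subseteq> A"
  proof clarify
    fix s assume s: "s \<in> L" "E s \<in> T"
    then have "Re s = c0" using out[of s] L[of s] by fastforce
    then have "s = Complex c0 \<alpha>1 \<or> s = Complex c0 \<alpha>2" using s(1) L[of s] by (auto simp: complex_eq_iff)
    then show "E s \<in> A" using ends by auto
  qed
  have MT: "E ` M \<beta> \<inter> T \<subseteq> B" if "E (Complex c0 \<beta>) \<in> B" for \<beta>
  proof clarify
    fix s assume s: "s \<in> M \<beta>" "E s \<in> T"
    then have "Re s = c0" using out[of s] M[of s] by fastforce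
    then have "s = Complex c0 \<beta>" using s(1) M[of s] by (auto simp: complex_eq_iff)
    then show "E s \<in> B" using that by auto
  qed
  have disj_ML: "E ` M \<beta> \<inter> E ` L = {}" if "\<beta> = \<beta>1 \<or> \<beta> = \<beta>2" for \<beta>
  proof (rule ccontr)
    assume "E ` M \<beta> \<inter> E ` L \<noteq> {}"
    then obtain s t where st: "s \<in> M \<beta>" "t \<in> L" "E s = E t" by blast
    have s: "c0 - 1/2 \<le> Re s" "Re s \<le> c0" "Im s = \<beta>" using st(1) by (simp_all add: M)
    have t: "Re t \<le> c0" "\<alpha>1 \<le> Im t" "Im t \<le> \<alpha>2"
      using st(2) ord unfolding L[of t] by linarith+
    have "s = t"
      by (rule same[OF st(3) s(2) t(1)]) (use t s(3) that ord in linarith)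
    then show False using st(2) s that ord unfolding L[of t] by force
  qed
  have ccT: "connected_component (- T) x y"
    unfolding connected_component_def
  proof (intro exI[of _ "- T"] conjI)
    show "connected (- T)"
      unfolding T(2)
      by (intro connected_continuous_image cont convex_connected convex_halfspace_Re_lt) auto
  qed (auto simp: x_def y_def out)
  have ccS: "connected_component (- S) x y"
    unfolding connected_component_def
  proof (intro exI[of _ "B \<union> E ` M \<beta>1 \<union> E ` M \<beta>2"] conjI)
    have "connected (E ` M \<beta>)" for \<beta>
      by (intro connected_continuous_image cont) (use M in \<open>auto simp: M_def intro: convex_connected\<close>)
    moreover have "E (Complex c0 \<beta>) \<in> E ` M \<beta>" for \<beta> using M by auto
    ultimately show "connected (B \<union> E ` M \<beta>1 \<union> E ` M \<beta>2)"
      using ends B(1) by (intro connected_Un) blast+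
    have "B \<inter> S = {}" using AB B(2) LT unfolding S_def by blast
    moreover have "E ` M \<beta> \<inter> S = {}"
      if "E (Complex c0 \<beta>) \<in> B" "\<beta> = \<beta>1 \<or> \<beta> = \<beta>2" for \<beta>
      using MT[OF that(1)] disj_ML[OF that(2)] AB A(3) unfolding S_def by blast
    from this[OF ends(3)] this[OF ends(4)] have "E ` M \<beta>1 \<inter> S = {}" "E ` M \<beta>2 \<inter> S = {}"
      by simp_all
    ultimately show "B \<union> E ` M \<beta>1 \<union> E ` M \<beta>2 \<subseteq> - S" by blast
  qed (auto simp: x_def y_def M)
  have "L \<subseteq> {s. Re s \<le> c0}" using L by auto
  moreover have "compact L" unfolding L_def by (intro compact_Un compact_cbox)
  ultimately have "compact (E ` L)" by (intro compact_continuous_image cont)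
  then have "compact S" using A by (auto simp: S_def)
  moreover have "S \<inter> T = A" using A LT by (auto simp: S_def)
  ultimately have "connected_component (- (S \<union> T)) x y"
    using Janiszewski[OF _ T(1) _ ccS ccT] A(2) by simp
  then obtain D where D: "connected D" "D \<subseteq> - (S \<union> T)" "x \<in> D" "y \<in> D"
    unfolding connected_component_def by blast
  have nc: "\<not> E constant_on {s. Re s < c1}"
  proof
    assume "E constant_on {s. Re s < c1}"
    then have "E (Complex c0 0) = E (Complex (c0 - 1) 0)"
      using c unfolding constant_on_def by fastforce
    then show False using re by fastforce
  qed
  have op: "open (E ` X)" if "open X" "X \<subseteq> {s. Re s < c0}" for X
    using that c
    by (intro open_mapping_thm[OF hol _ _ _ _ nc] open_halfspace_Re_lt convex_connected
        convex_halfspace_Re_lt) auto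
  have "open W1" "open W2"
    unfolding W1_def W2_def
    by (intro op open_Un open_box; auto simp: in_box_complex_iff intro!: open_Collect_conj
        open_Collect_less continuous_intros)+
  moreover have "D \<subseteq> W1 \<union> W2"
  proof
    fix z assume z: "z \<in> D"
    then obtain s where s: "Re s < c0" "z = E s" using D T by blast
    obtain t where t: "Re t = Re s" "\<alpha>1 \<le> Im t" "Im t < \<alpha>1 + 2 * pi" "exp t = exp s"
      using exp_representative by blast
    then have zt: "z = E t" using inj[of t s] s c by simp
    then have "t \<notin> L" using z D by (auto simp: S_def)
    then have "t \<in> box (Complex (c0 - 1) \<alpha>1) (Complex c0 \<alpha>2) \<or> Re t < c0 - 1 \<or>
        Re t < c0 \<and> \<alpha>2 < Im t \<and> Im t < \<alpha>1 + 2 * pi"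
      using t s unfolding L by (auto simp: in_box_complex_iff)
    then show "z \<in> W1 \<union> W2" using zt unfolding W1_def W2_def by blast
  qed
  moreover have "W1 \<inter> W2 = {}"
  proof (rule ccontr)
    assume "W1 \<inter> W2 \<noteq> {}"
    then obtain s t where st: "s \<in> box (Complex (c0 - 1) \<alpha>1) (Complex c0 \<alpha>2)" "E s = E t"
      "Re t < c0 - 1 \<or> (Re t < c0 \<and> \<alpha>2 < Im t \<and> Im t < \<alpha>1 + 2 * pi)"
      unfolding W1_def W2_def by blast
    have s: "c0 - 1 < Re s" "Re s < c0" "\<alpha>1 < Im s" "Im s < \<alpha>2"
      using st(1) by (auto simp: in_box_complex_iff)
    then have "Re s = Re t" using re[OF st(2)] st(3) by force
    then have "\<alpha>2 < Im t" "Im t < \<alpha>1 + 2 * pi" "Re t < c0" using st(3) s by auto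
    moreover from this have "s = t" using same[OF st(2)] s by force
    ultimately show False using s by auto
  qed
  moreover have "x \<in> W1"
    unfolding W1_def x_def using ord by (intro imageI) (auto simp: in_box_complex_iff)
  moreover have "y \<in> W2"
    unfolding W2_def y_def using ord by (intro imageI) auto
  ultimately show False using D(1,3,4) unfolding connected_def by blast
qed

section \<open>Compact sets lying over thin plane sets\<close>

lemma poly_not_constant_on_UNIV:
  fixes P :: "complex poly"
  assumes "degree P > 0" shows "\<not> poly P constant_on UNIV"
proof
  assume "poly P constant_on UNIV"
  then obtain c where "poly P = poly [:c:]" by (auto simp: constant_on_def fun_eq_iff)
  then show False using assms by (simp add: poly_eq_poly_eq_iff)
qed

text \<open>A bounded component \<open>D\<close> of \<open>- Q\<close> would have an open image, too
  fat to lie in \<open>K\<close> and too small to cover the unbounded set \<open>- K\<close>. Some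
  frontier point of the image would then lie off \<open>K\<close>, although it comes from the
  frontier of \<open>D\<close>, which is part of \<open>Q\<close> and maps into
  \<open>K\<close>.\<close>

lemma connected_Compl_over_thin_set:
  fixes P :: "complex poly"
  assumes "degree P > 0" and K: "connected (- K)" "interior K = {}" "compact K"
    and Q: "compact Q" "poly P ` Q \<subseteq> K"
  shows "connected (- Q)"
proof (rule ccontr)
  assume "\<not> connected (- Q)"
  then obtain D where D: "D \<in> components (- Q)" "bounded D"
    using cobounded_has_bounded_component[of "- Q"] Q(1) by (auto simp: compact_imp_bounded)
  have oD: "open D" "D \<noteq> {}"
    using D Q(1) open_components[of "- Q" D] in_components_nonempty
    by (auto simp: open_Compl compact_imp_closed)
  have oP: "open (poly P ` D)"
    by (rule open_mapping_thm[OF _ open_UNIV connected_UNIV oD(1) _ poly_not_constant_on_UNIV[OF assms(1)]]) (auto intro: holomorphic_intros)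
  have "\<not> poly P ` D \<subseteq> K"
    using interior_maximal[OF _ oP] K(2) oD(2) by blast
  moreover have "\<not> - K \<subseteq> poly P ` D"
  proof
    assume "- K \<subseteq> poly P ` D"
    moreover have "bounded (poly P ` closure D)"
      using D(2) by (intro compact_imp_bounded compact_continuous_image continuous_intros) auto
    ultimately have "bounded (- K \<union> K)"
      using K(3) bounded_subset closure_subset[of D]
      by (metis bounded_Un compact_imp_bounded image_mono)
    then show False by simp
  qed
  ultimately have "- K \<inter> frontier (poly P ` D) \<noteq> {}"
    using connected_Int_frontier[OF K(1), of "poly P ` D"] by blast
  then obtain w where w: "w \<notin> K" "w \<in> closure (poly P ` D)" "w \<notin> poly P ` D"
    using oP by (auto simp: frontier_def interior_open)
  have "compact (poly P ` closure D)"
    using D(2) by (intro compact_continuous_image continuous_intros) auto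
  then have "closure (poly P ` D) \<subseteq> poly P ` closure D"
    by (intro closure_minimal image_mono closure_subset compact_imp_closed)
  then obtain z where z: "z \<in> closure D" "w = poly P z" using w by blast
  then have "z \<in> frontier D" using w oD by (auto simp: frontier_def interior_open)
  then have "z \<in> Q"
    using frontier_of_components_subset[OF D(1)] frontier_subset_closed[of Q] Q(1)
    by (auto simp: compact_imp_closed)
  then show False using z w Q by blast
qed

lemma interior_arc_image:
  fixes g :: "real \<Rightarrow> complex"
  assumes "arc g" shows "interior (path_image g) = {}"
proof (rule ccontr)
  assume ne: "interior (path_image g) \<noteq> {}"
  obtain h where h: "homeomorphism {0..1} (path_image g) g h"
    using homeomorphism_arc[OF assms] by blast
  have "DIM(complex) \<le> DIM(real)"
  proof (rule invariance_of_dimension[of "interior (path_image g)" h])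
    show "continuous_on (interior (path_image g)) h"
      using h by (meson homeomorphism_def continuous_on_subset interior_subset)
    show "inj_on h (interior (path_image g))"
      by (rule inj_on_subset[OF inj_on_inverseI interior_subset]) (rule homeomorphism_apply2[OF h])
  qed (use ne in auto)
  then show False by simp
qed

subsection \<open>Local structure of polynomials and branches\<close>

text \<open>Here \<open>m\<close> is the order of the zero of \<open>poly P z - poly P a\<close> at
  \<open>a\<close>. The cofactor has a local \<open>m\<close>-th root \<open>g\<close>, and
  \<open>\<psi> w = (w - a) * g w\<close> is a local coordinate since
  \<open>g a \<noteq> 0\<close>.\<close>

lemma poly_locally_power:
  fixes P :: "complex poly"
  assumes "degree P > 0"
  obtains \<psi> m r where "r > 0" "m > 0" "\<psi> holomorphic_on ball a r" "\<psi> a = 0" "deriv \<psi> a \<noteq> 0"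
    "\<And>z. z \<in> ball a r \<Longrightarrow> poly P z - poly P a = \<psi> z ^ m"
proof -
  have hol: "poly P holomorphic_on UNIV" by (intro holomorphic_intros)
  have "\<exists>n>0. (deriv ^^ n) (poly P) a \<noteq> 0"
  proof (rule ccontr)
    assume "\<not> ?thesis"
    then have "poly P w = poly P a" for w
      by (intro holomorphic_fun_eq_const_on_connected[OF hol open_UNIV connected_UNIV]) blast+
    then show False using poly_not_constant_on_UNIV[OF assms] by (auto simp: constant_on_def)
  qed
  then obtain m where m: "m > 0" "(deriv ^^ m) (poly P) a \<noteq> 0"
      "\<And>i. 0 < i \<Longrightarrow> i < m \<Longrightarrow> (deriv ^^ i) (poly P) a = 0"
    using exists_least_iff[of "\<lambda>n. n > 0 \<and> (deriv ^^ n) (poly P) a \<noteq> 0"] by blast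
  obtain g r where g: "r > 0" "g holomorphic_on ball a r"
      "\<And>w. w \<in> ball a r \<Longrightarrow> poly P w - poly P a = ((w - a) * g w) ^ m"
      "\<And>w. w \<in> ball a r \<Longrightarrow> g w \<noteq> 0"
    using holomorphic_factor_order_of_zero_strong[OF hol open_UNIV UNIV_I m] by metis
  define \<psi> where "\<psi> w = (w - a) * g w" for w
  have "(g has_field_derivative deriv g a) (at a)"
    using g(1,2) by (intro holomorphic_derivI[of g "ball a r"]) auto
  then have "(\<psi> has_field_derivative g a) (at a)"
    unfolding \<psi>_def by (auto intro!: derivative_eq_intros)
  then have "deriv \<psi> a = g a" by (rule DERIV_imp_deriv)
  moreover have "\<psi> holomorphic_on ball a r"
    unfolding \<psi>_def by (intro holomorphic_intros g)
  ultimately show ?thesis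
    using g m(1) by (intro that[of r m \<psi>]) (auto simp: \<psi>_def)
qed

lemma power_eq_real_multiple:
  fixes x y :: "'a::{real_normed_field}"
  assumes "m > 0" "0 \<le> s" "0 \<le> t" "(of_real s * x) ^ m = (of_real t * y) ^ m" "x ^ m = y ^ m" "x \<noteq> 0"
  shows "s = t"
proof -
  have "of_real (s ^ m) * x ^ m = of_real (t ^ m) * x ^ m"
    using assms(4,5) by (simp add: power_mult_distrib)
  then have "s ^ m = t ^ m" using assms(6) by (simp del: of_real_power)
  then show ?thesis using assms(1-3) by (simp add: power_eq_iff_eq_base)
qed

text \<open>In the coordinate \<open>\<psi>\<close> the polynomial is an \<open>m\<close>-th power,
  so the radial segment from 0 to \<open>\<psi> z\<close> lies over the segment from
  \<open>poly P a\<close> to \<open>poly P z\<close>. Radial segments ending at different points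
  with equal \<open>m\<close>-th power meet only at 0.\<close>

lemma local_segment_lifts:
  fixes P :: "complex poly"
  assumes "degree P > 0" "e > 0"
  obtains d L where "d > 0"
    "\<And>z. z \<in> ball a d \<Longrightarrow> compact (L z) \<and> connected (L z) \<and> a \<in> L z \<and> z \<in> L z \<and> L z \<subseteq> ball a e \<and>
        poly P ` L z \<subseteq> closed_segment (poly P a) (poly P z)"
    "\<And>z w. z \<in> ball a d \<Longrightarrow> z \<noteq> a \<Longrightarrow> w \<in> L z \<Longrightarrow> poly P w = poly P z \<Longrightarrow> w = z"
    "\<And>z w. z \<in> ball a d \<Longrightarrow> w \<in> ball a d \<Longrightarrow> z \<noteq> a \<Longrightarrow> poly P z = poly P w \<Longrightarrow> z \<noteq> w \<Longrightarrow>
        L z \<inter> L w \<subseteq> {a}"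
proof -
  obtain \<psi> m r where \<psi>: "r > 0" "m > 0" "\<psi> holomorphic_on ball a r" "\<psi> a = 0" "deriv \<psi> a \<noteq> 0"
    and pw: "\<And>z. z \<in> ball a r \<Longrightarrow> poly P z - poly P a = \<psi> z ^ m"
    using poly_locally_power[OF assms(1)] by metis
  have hol: "\<psi> holomorphic_on ball a (min r e)"
    by (rule holomorphic_on_subset[OF \<psi>(3)]) auto
  obtain u where u: "u > 0" "ball a u \<subseteq> ball a (min r e)" "open (\<psi> ` ball a u)" "inj_on \<psi> (ball a u)"
    using has_complex_derivative_locally_invertible[OF hol _ _ \<psi>(5)] \<psi>(1) assms(2) by auto
  have holu: "\<psi> holomorphic_on ball a u" by (rule holomorphic_on_subset[OF hol u(2)])
  obtain h where h: "h holomorphic_on \<psi> ` ball a u" "\<And>z. z \<in> ball a u \<Longrightarrow> h (\<psi> z) = z"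
    using holomorphic_has_inverse[OF holu open_ball u(4)] by metis
  \<comment> \<open>The inverse \<open>h\<close> must be defined along whole radial segments; a disc
    around 0 inside its domain is convex, and \<open>d\<close> is chosen so that
    \<open>\<psi>\<close> maps \<open>ball a d\<close> into it.\<close>
  obtain s where s: "s > 0" "ball 0 s \<subseteq> \<psi> ` ball a u"
    using u(1,3) \<psi>(4) unfolding open_contains_ball by (metis centre_in_ball imageI)
  have hin: "h w \<in> ball a u" "\<psi> (h w) = w" if "w \<in> ball 0 s" for w
    using s(2) that h(2) by auto
  have "open (ball a u \<inter> \<psi> -` ball 0 s)"
    using holu by (intro continuous_open_preimage holomorphic_on_imp_continuous_on) auto
  moreover have "a \<in> ball a u \<inter> \<psi> -` ball 0 s" using u(1) s(1) \<psi>(4) by simp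
  ultimately obtain d where d: "d > 0" "ball a d \<subseteq> ball a u \<inter> \<psi> -` ball 0 s"
    unfolding open_contains_ball by blast
  define L where "L z = h ` closed_segment 0 (\<psi> z)" for z
  have seg: "closed_segment 0 (\<psi> z) \<subseteq> ball 0 s" if "z \<in> ball a d" for z
    using d(2) that s(1) by (intro closed_segment_subset) auto
  have zu: "z \<in> ball a u" if "z \<in> ball a d" for z using d(2) that by blast
  have Lw: "\<exists>t. 0 \<le> t \<and> t \<le> 1 \<and> \<psi> w = of_real t * \<psi> z \<and> w \<in> ball a u \<and> h (\<psi> w) = w"
    if z: "z \<in> ball a d" "w \<in> L z" for z w
  proof -
    obtain v where v: "v \<in> closed_segment 0 (\<psi> z)" "w = h v" using z(2) unfolding L_def by blast
    then have "v \<in> ball 0 s" using seg[OF z(1)] by blast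
    with v show ?thesis using hin[of v] unfolding in_segment by (auto simp: scaleR_conv_of_real)
  qed
  have ur: "ball a u \<subseteq> ball a r" "ball a u \<subseteq> ball a e" using u(2) by auto
  have \<psi>0: "\<psi> z \<noteq> 0" if "z \<in> ball a d" "z \<noteq> a" for z
    using inj_onD[OF u(4), of z a] that zu u(1) \<psi>(4) by auto
  show ?thesis
  proof (rule that[OF d(1)])
    fix z assume z: "z \<in> ball a d"
    have cont: "continuous_on (closed_segment 0 (\<psi> z)) h"
      by (rule continuous_on_subset[OF holomorphic_on_imp_continuous_on[OF h(1)]])
        (use seg[OF z] s(2) in blast)
    have "compact (L z)" "connected (L z)"
      unfolding L_def by (intro compact_continuous_image connected_continuous_image cont; simp)+
    moreover have "a \<in> L z" "z \<in> L z"
      unfolding L_def using h(2)[of a] h(2)[OF zu[OF z]] u(1) \<psi>(4) by (force simp: image_iff)+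
    moreover have "L z \<subseteq> ball a e" using Lw[OF z] ur(2) by blast
    moreover have "poly P ` L z \<subseteq> closed_segment (poly P a) (poly P z)"
    proof clarify
      fix w assume "w \<in> L z"
      then obtain t where t: "0 \<le> t" "t \<le> 1" "\<psi> w = of_real t * \<psi> z" "w \<in> ball a u"
        using Lw[OF z] by blast
      have "poly P w - poly P a = of_real (t ^ m) * (poly P z - poly P a)"
        using pw[OF subsetD[OF ur(1) t(4)]] pw[OF subsetD[OF ur(1) zu[OF z]]] t(3)
        by (simp add: power_mult_distrib)
      then have "poly P w = (1 - t ^ m) *\<^sub>R poly P a + (t ^ m) *\<^sub>R poly P z"
        by (simp add: scaleR_conv_of_real algebra_simps)
      moreover have "0 \<le> t ^ m" "t ^ m \<le> 1" using t by (simp_all add: power_le_one)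
      ultimately show "poly P w \<in> closed_segment (poly P a) (poly P z)"
        unfolding in_segment by blast
    qed
    ultimately show "compact (L z) \<and> connected (L z) \<and> a \<in> L z \<and> z \<in> L z \<and> L z \<subseteq> ball a e \<and>
        poly P ` L z \<subseteq> closed_segment (poly P a) (poly P z)" by blast
  next
    fix z w assume z: "z \<in> ball a d" "z \<noteq> a" "w \<in> L z" "poly P w = poly P z"
    then obtain t where t: "0 \<le> t" "\<psi> w = of_real t * \<psi> z" "w \<in> ball a u" "h (\<psi> w) = w"
      using Lw by blast
    have "(of_real t * \<psi> z) ^ m = (of_real 1 * \<psi> z) ^ m"
      using pw[OF subsetD[OF ur(1) t(3)]] pw[OF subsetD[OF ur(1) zu[OF z(1)]]] t(2) z(4) by simp
    then have "t = 1"
      using t(1) \<psi>(2) \<psi>0[OF z(1,2)] by (intro power_eq_real_multiple[where x = "\<psi> z" and y = "\<psi> z"]) auto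
    then have "\<psi> w = \<psi> z" using t(2) by simp
    then show "w = z" using t(4) h(2)[OF zu[OF z(1)]] by metis
  next
    fix z w assume z: "z \<in> ball a d" "w \<in> ball a d" "z \<noteq> a" "poly P z = poly P w" "z \<noteq> w"
    show "L z \<inter> L w \<subseteq> {a}"
    proof
      fix v assume v: "v \<in> L z \<inter> L w"
      then obtain t where t: "0 \<le> t" "\<psi> v = of_real t * \<psi> z" "h (\<psi> v) = v"
        using Lw[OF z(1)] by blast
      obtain t' where t': "0 \<le> t'" "\<psi> v = of_real t' * \<psi> w" using v Lw[OF z(2)] by blast
      have e: "\<psi> z ^ m = \<psi> w ^ m"
        using pw[of z] pw[of w] z ur(1) zu by (metis subsetD)
      have "t = t'"
        using t t' e \<psi>(2) \<psi>0[OF z(1,3)]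
        by (intro power_eq_real_multiple[where x = "\<psi> z" and y = "\<psi> w"]) auto
      moreover have "\<psi> z \<noteq> \<psi> w" using inj_onD[OF u(4)] z zu by blast
      ultimately have "t = 0" using t(2) t'(2) by auto
      then show "v \<in> {a}" using t h(2)[of a] u(1) \<psi>(4) by simp
    qed
  qed
qed

text \<open>Away from critical values \<open>poly P\<close> is locally injective, so the set where
  two branches agree is open as well as closed.\<close>

lemma inverse_branches_eq:
  assumes U: "open U" "connected U" "U \<inter> critical_values P = {}"
    and f: "inverse_branch P U f" and g: "inverse_branch P U g"
    and w: "w \<in> U" "f w = g w" and z: "z \<in> U"
  shows "f z = g z"
proof -
  have cont: "continuous_on U f" "continuous_on U g"
    using f g by (auto simp: inverse_branch_def intro: holomorphic_on_imp_continuous_on)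
  have inv: "poly P (f x) = x" "poly P (g x) = x" if "x \<in> U" for x
    using f g that by (auto simp: inverse_branch_def)
  have "open {x\<in>U. f x = g x}"
  proof (subst open_subopen, clarify)
    fix x assume x: "x \<in> U" "f x = g x"
    have "deriv (poly P) (f x) \<noteq> 0"
      using x U(3) inv[OF x(1)] by (force simp: critical_values_def DERIV_imp_deriv[OF poly_DERIV])
    moreover have "poly P holomorphic_on UNIV" by (intro holomorphic_intros)
    ultimately obtain r where r: "r > 0" "inj_on (poly P) (ball (f x) r)"
      using has_complex_derivative_locally_injective[of "poly P" UNIV "f x"] by auto
    let ?N = "(U \<inter> f -` ball (f x) r) \<inter> (U \<inter> g -` ball (f x) r)"
    have "open ?N" by (intro open_Int continuous_open_preimage cont U open_ball)
    moreover have "x \<in> ?N" using x r by simp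
    moreover have "?N \<subseteq> {x\<in>U. f x = g x}" using inj_onD[OF r(2)] inv by auto
    ultimately show "\<exists>T. open T \<and> x \<in> T \<and> T \<subseteq> {x\<in>U. f x = g x}" by blast
  qed
  then have "openin (top_of_set U) {x\<in>U. f x = g x}" by (auto simp: openin_open)
  moreover have "closedin (top_of_set U) {x\<in>U. f x = g x}"
  proof -
    have "{x\<in>U. f x = g x} = {x\<in>U. f x - g x = 0}" by auto
    then show ?thesis
      using continuous_closedin_preimage_constant[of U "\<lambda>x. f x - g x" 0] cont
      by (simp add: continuous_on_diff)
  qed
  ultimately have "{x\<in>U. f x = g x} = U" using U(2) w unfolding connected_clopen by blast
  then show ?thesis using z by blast
qed

subsection \<open>Puiseux series at infinity\<close>

lemma root_of_unity_power: "root_of_unity n ^ k = exp (2 * of_real pi * \<i> * of_nat k / of_nat n)"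
  unfolding root_of_unity_def exp_of_nat_mult[symmetric] by (simp add: mult_ac)

lemma root_of_unity_power_eq_circle_point: "root_of_unity n ^ k = circle_point n (of_int (int k))"
  by (simp add: root_of_unity_power circle_point_def cis_conv_exp mult_ac)

text \<open>Multiplication by \<open>\<omega> ^ j / x\<close> removes the polar term
  \<open>k = -1\<close>; all branches become values of one power series at rotated
  arguments.\<close>

lemma puiseux_has_sum_imp_sums:
  fixes v :: "int \<Rightarrow> complex" and \<omega> x :: complex
  assumes "((\<lambda>k. v k * \<omega> powi (int j * k) * x powi (- k)) has_sum l) {-1..}" and "x \<noteq> 0" "\<omega> \<noteq> 0"
  shows "(\<lambda>m. v (int m - 1) * (\<omega> ^ j / x) ^ m) sums (\<omega> ^ j / x * l)"
proof -
  define t where "t = \<omega> ^ j / x"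
  have t: "t \<noteq> 0" using assms by (simp add: t_def)
  have bij: "bij_betw (\<lambda>m. int m - 1) UNIV {-1..}"
    by (rule bij_betwI[where g = "\<lambda>k. nat (k + 1)"]) auto
  have shift: "t * (v k * \<omega> powi (int j * k) * x powi (- k)) = v k * t powi (k + 1)" for k
  proof -
    have "\<omega> powi (int j * k) * x powi (- k) = t powi k"
      using assms(2,3) by (simp add: t_def power_int_mult power_int_divide_distrib power_int_minus_divide)
    then show ?thesis using t by (simp add: power_int_add mult_ac)
  qed
  have "((\<lambda>k. t * (v k * \<omega> powi (int j * k) * x powi (- k))) has_sum t * l) {-1..}"
    by (intro has_sum_cmult_right assms)
  then have "((\<lambda>m. v (int m - 1) * t powi (int m - 1 + 1)) has_sum t * l) UNIV"
    unfolding shift by (subst has_sum_reindex_bij_betw[OF bij])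
  then show ?thesis
    unfolding t_def[symmetric] by (intro has_sum_imp_sums) simp
qed

text \<open>The left side still makes sense at \<open>t = 0\<close>, which corresponds to the point
  at infinity.\<close>

lemma sum_coeff_homogenized:
  fixes P :: "'a::field poly"
  assumes "t \<noteq> 0"
  shows "(\<Sum>i\<le>degree P. coeff P i * x ^ i * t ^ (degree P - i)) = t ^ degree P * poly P (x / t)"
  unfolding poly_altdef sum_distrib_left
proof (rule sum.cong)
  fix i assume "i \<in> {..degree P}"
  then have "t ^ degree P = t ^ (degree P - i) * t ^ i" by (simp flip: power_add)
  then show "coeff P i * x ^ i * t ^ (degree P - i) = t ^ degree P * (coeff P i * (x / t) ^ i)"
    using assms by (simp add: power_divide)
qed auto

text \<open>
  With \<open>h t = (\<Sum>m. v (m - 1) * t ^ m)\<close>, the Puiseux series is \<open>h t / t\<close> at \<open>t = \<omega> ^ j / \<rho> z\<close>.  The identity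
  \<open>t ^ n * P (h t / t) = 1\<close> holds on an open set of such \<open>t\<close>, hence on a disc; written without
  denominators (\<open>Q\<close> below) it gives \<open>h 0 \<noteq> 0\<close>, so that \<open>t / h t\<close> is injective near 0.
\<close>
lemma canonical_numeration_uniformized:
  assumes n: "degree P = n" "n > 0" and can: "canonical_numeration P U f"
  obtains V E c where "open V" "connected V" "V \<subseteq> U" "\<not> bounded V"
    "E holomorphic_on {s. Re s < c}"
    "\<And>s t. Re s < c \<Longrightarrow> Re t < c \<Longrightarrow> E s = E t \<longleftrightarrow> exp s = exp t"
    "\<And>s. Re s < c \<Longrightarrow> poly P (E s) = exp (- of_nat n * s)"
    "\<And>z. exp (- real n * c) < norm (poly P z) \<Longrightarrow> z \<in> E ` {s. Re s < c}"
    "\<And>q. q \<in> V \<Longrightarrow> exp (- real n * c) < norm q \<Longrightarrow>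
       \<exists>\<sigma>. Re \<sigma> = - ln (norm q) / n \<and> (\<forall>k<n. f k q = E (\<sigma> + 2 * of_real pi * \<i> * of_nat k / of_nat n))"
proof -
  obtain V \<rho> and v :: "int \<Rightarrow> complex" where V: "open V" "connected V" "V \<subseteq> U" "0 \<notin> V" "None \<in> sphere_boundary V"
    and \<rho>: "\<rho> holomorphic_on V" "\<And>z. z \<in> V \<Longrightarrow> \<rho> z ^ n = z"
    and fsum: "\<And>j z. j < n \<Longrightarrow> z \<in> V \<Longrightarrow>
       ((\<lambda>k. v k * root_of_unity n powi (int j * k) * \<rho> z powi (- k)) has_sum f j z) {-1..}"
    using can unfolding canonical_numeration_def n(1) by blast
  have Pf: "poly P (f 0 z) = z" if "z \<in> V" for z
    using can n that V(3) by (auto simp: canonical_numeration_def inverse_branch_def)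
  have ub: "\<not> bounded V" using infinite_sphere_boundary[OF V(5)] .
  define \<omega> where "\<omega> = root_of_unity n"
  have \<omega>0: "\<omega> \<noteq> 0" by (simp add: \<omega>_def root_of_unity_def)
  have norm\<omega>: "norm (\<omega> ^ j) = 1" for j
    by (simp add: \<omega>_def root_of_unity_power)
  have \<rho>0: "\<rho> z \<noteq> 0" if "z \<in> V" for z using \<rho>(2)[OF that] that V(4) n(2) by (metis zero_power)
  have norm\<rho>: "norm (\<rho> z) ^ n = norm z" if "z \<in> V" for z using \<rho>(2)[OF that] by (metis norm_power)
  have "V \<noteq> {}" using ub by auto
  then obtain z0 where z0: "z0 \<in> V" by blast
  \<comment> \<open>Convergence at the single point \<open>1 / \<rho> z0\<close> gives convergence
    in the disc of radius \<open>r0\<close>.\<close>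
  define r0 a h where "r0 = 1 / norm (\<rho> z0)" and "a = (\<lambda>m. v (int m - 1))" and "h t = (\<Sum>m. a m * t ^ m)" for t
  have r0: "r0 > 0" using \<rho>0[OF z0] by (simp add: r0_def)
  have psum: "(\<lambda>m. a m * (\<omega> ^ j / \<rho> z) ^ m) sums (\<omega> ^ j / \<rho> z * f j z)" if "j < n" "z \<in> V" for j z
    using puiseux_has_sum_imp_sums[OF fsum[OF that], OF \<rho>0[OF that(2)]] \<omega>0
    unfolding \<omega>_def[symmetric] a_def by simp
  have "summable (\<lambda>m. a m * (1 / \<rho> z0) ^ m)"
    using psum[OF n(2) z0] by (auto intro: sums_summable)
  then have smb: "summable (\<lambda>m. a m * t ^ m)" if "norm t < r0" for t
    using powser_inside[of a "1 / \<rho> z0" t] that by (simp add: r0_def norm_divide)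
  have holh: "h holomorphic_on ball 0 r0"
    by (rule power_series_holomorphic[of 0 r0 a h]) (use smb in \<open>auto simp: h_def summable_sums\<close>)
  have h_eq: "h (\<omega> ^ j / \<rho> z) = \<omega> ^ j / \<rho> z * f j z" if "j < n" "z \<in> V" for j z
    unfolding h_def using psum[OF that] by (rule sums_unique[symmetric])
  have \<rho>small: "norm (1 / \<rho> z) < r0" if "z \<in> V" "norm z0 < norm z" for z
  proof -
    have "norm (\<rho> z0) < norm (\<rho> z)"
      using that norm\<rho>[OF that(1)] norm\<rho>[OF z0] power_less_imp_less_base by (metis norm_ge_zero)
    then show ?thesis using \<rho>0[OF z0] by (simp add: r0_def norm_divide frac_less2)
  qed
  define Q where "Q t = (\<Sum>i\<le>degree P. coeff P i * h t ^ i * t ^ (degree P - i))" for t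
  \<comment> \<open>On \<open>V1\<close> the argument \<open>1 / \<rho> z\<close> stays inside the
    open disc. It determines \<open>z\<close>, so these arguments form an open set, from which the
    polynomial identity is continued to the disc.\<close>
  define V1 where "V1 = V \<inter> {z. norm z0 < norm z}"
  have oV1: "open V1" unfolding V1_def by (intro open_Int V open_Collect_less continuous_intros)
  have V1ne: "V1 \<noteq> {}"
  proof
    assume "V1 = {}"
    then have "V \<subseteq> cball 0 (norm z0)" by (force simp: V1_def)
    then show False using ub bounded_cball bounded_subset by blast
  qed
  have hol\<rho>: "(\<lambda>z. 1 / \<rho> z) holomorphic_on V1"
    by (rule holomorphic_on_subset[of _ V]) (use \<rho> \<rho>0 in \<open>auto simp: V1_def intro!: holomorphic_intros\<close>)
  have inj\<rho>: "inj_on (\<lambda>z. 1 / \<rho> z) V1"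
    by (rule inj_on_inverseI[where g = "\<lambda>t. (1 / t) ^ n"]) (use \<rho> \<rho>0 in \<open>auto simp: V1_def\<close>)
  have oS: "open ((\<lambda>z. 1 / \<rho> z) ` V1)" by (rule open_mapping_thm3[OF hol\<rho> oV1 inj\<rho>])
  have holQ: "Q holomorphic_on ball 0 r0"
    unfolding Q_def by (intro holomorphic_intros holh)
  have Q1: "Q t = 1" if "t \<in> ball 0 r0" for t
  proof (rule analytic_continuation_open[OF oS open_ball _ connected_ball _ holQ holomorphic_on_const _ that])
    show "(\<lambda>z. 1 / \<rho> z) ` V1 \<subseteq> ball 0 r0" using \<rho>small by (auto simp: V1_def)
    fix t assume "t \<in> (\<lambda>z. 1 / \<rho> z) ` V1"
    then obtain z where z: "z \<in> V" "t = 1 / \<rho> z" by (auto simp: V1_def)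
    have t0: "t \<noteq> 0" using z \<rho>0 by simp
    have "h t / t = f 0 z" using h_eq[OF n(2) z(1)] t0 z(2) by simp
    then have "Q t = t ^ n * z"
      using sum_coeff_homogenized[OF t0, of P "h t"] n(1) Pf[OF z(1)] by (simp add: Q_def)
    also have "t ^ n = 1 / z" unfolding z(2) power_divide \<rho>(2)[OF z(1)] by simp
    also have "1 / z * z = 1" using z(1) V(4) by auto
    finally show "Q t = 1" .
  qed (use V1ne in simp)
  have Pg: "t ^ n * poly P (h t / t) = 1" if "t \<noteq> 0" "norm t < r0" for t
    using Q1[of t] that sum_coeff_homogenized[OF that(1), of P "h t"] by (simp add: Q_def n(1))
  have h0: "h 0 \<noteq> 0"
  proof
    assume "h 0 = 0"
    then have "coeff P i * h 0 ^ i * 0 ^ (degree P - i) = 0" for i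
      using n by (cases "i = 0") auto
    then have "Q 0 = 0" unfolding Q_def by (intro sum.neutral ballI)
    then show False using Q1[of 0] r0 by simp
  qed
  have conth: "continuous_on (ball 0 r0) h" using holh by (rule holomorphic_on_imp_continuous_on)
  have "open (ball 0 r0 \<inter> h -` (- {0}))" by (intro continuous_open_preimage conth) auto
  moreover have "0 \<in> ball 0 r0 \<inter> h -` (- {0})" using r0 h0 by simp
  ultimately obtain r1 where r1: "r1 > 0" "ball 0 r1 \<subseteq> ball 0 r0 \<inter> h -` (- {0})"
    unfolding open_contains_ball by blast
  define H where "H t = t / h t" for t
  have hol1: "h holomorphic_on ball 0 r1" by (rule holomorphic_on_subset[OF holh]) (use r1 in blast)
  have hne: "h t \<noteq> 0" "norm t < r0" if "norm t < r1" for t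
  proof -
    have "t \<in> ball 0 r1" using that by simp
    then have "t \<in> ball 0 r0 \<inter> h -` (- {0})" using r1(2) by blast
    then show "h t \<noteq> 0" "norm t < r0" by auto
  qed
  have holH: "H holomorphic_on ball 0 r1"
    unfolding H_def by (intro holomorphic_intros hol1) (simp add: hne)
  have "(h has_field_derivative deriv h 0) (at 0)"
    using r1 hol1 by (intro holomorphic_derivI[of h "ball 0 r1"]) auto
  then have "(H has_field_derivative 1 / h 0) (at 0)"
    unfolding H_def using h0 by (auto intro!: derivative_eq_intros simp: field_simps)
  then have dH: "deriv H 0 \<noteq> 0" using h0 by (simp add: DERIV_imp_deriv)
  have "(0::complex) \<in> ball 0 r1" using r1(1) by simp
  then obtain r2 where r2: "r2 > 0" "ball 0 r2 \<subseteq> ball (0::complex) r1" "open (H ` ball 0 r2)" "inj_on H (ball 0 r2)"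
    using has_complex_derivative_locally_invertible[OF holH _ open_ball dH] by metis
  have r21: "norm t < r1" if "norm t < r2" for t :: complex using r2(2) that by (auto simp: subset_iff)
  have "0 \<in> H ` ball 0 r2" using r2(1) by (intro image_eqI[of _ _ 0]) (auto simp: H_def)
  then obtain \<delta> where \<delta>: "\<delta> > 0" "ball 0 \<delta> \<subseteq> H ` ball 0 r2"
    using r2(3) unfolding open_contains_ball by blast
  have "compact (poly P ` cball 0 (1 / \<delta>))"
    by (intro compact_continuous_image continuous_intros) auto
  \<comment> \<open>A value of \<open>poly P\<close> larger than \<open>M\<close> forces
    \<open>norm z > 1 / \<delta>\<close>, and then \<open>1 / z\<close> is a value of
    \<open>H\<close>.\<close>
  then obtain M where M: "\<And>z. norm z \<le> 1 / \<delta> \<Longrightarrow> norm (poly P z) \<le> M"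
    using compact_imp_bounded[of "poly P ` cball 0 (1 / \<delta>)"] unfolding bounded_iff by force
  define M1 where "M1 = Max {M, norm z0, 1}"
  \<comment> \<open>The first bound keeps \<open>exp s\<close> in the disc where \<open>H\<close> is
    injective. The second gives \<open>M1 \<le> exp (- real n * c)\<close>, so that \<open>M\<close>
    is exceeded beyond that radius.\<close>
  define c where "c = min (ln r2) (- ln M1 / n)"
  have M1: "M \<le> M1" "norm z0 \<le> M1" "1 \<le> M1" by (auto simp: M1_def)
  have c1: "exp c \<le> r2" using r2(1) by (simp add: c_def flip: ln_ge_iff)
  have c2: "M1 \<le> exp (- real n * c)"
  proof -
    have "real n * c \<le> real n * (- ln M1 / n)" by (intro mult_left_mono) (auto simp: c_def)
    then have "ln M1 \<le> - real n * c" using n(2) by simp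
    then have "exp (ln M1) \<le> exp (- real n * c)" by (simp only: exp_le_cancel_iff)
    then show ?thesis using M1(3) by simp
  qed
  \<comment> \<open>Passing to a logarithm of \<open>t\<close> turns multiplication by a root of
    unity, that is a change of branch, into a translation by a multiple of
    \<open>2 * pi * \<i> / n\<close>.\<close>
  define E where "E s = h (exp s) / exp s" for s
  have EH: "H (exp s) = 1 / E s" for s by (simp add: H_def E_def)
  have es: "norm (exp s) < r2" if "Re s < c" for s
    using that c1 by (smt (verit) exp_less_cancel_iff norm_exp_eq_Re)
  have er: "norm (exp s) < r0" if "Re s < c" for s using hne(2)[OF r21[OF es[OF that]]] .
  show ?thesis
  proof (rule that[OF V(1,2,3) ub, of E c])
    show "E holomorphic_on {s. Re s < c}"
      unfolding E_def using er
      by (intro holomorphic_intros holomorphic_on_compose_gen[OF _ holh, unfolded o_def]) auto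
    show "E s = E t \<longleftrightarrow> exp s = exp t" if "Re s < c" "Re t < c" for s t
    proof
      assume "E s = E t"
      then have "H (exp s) = H (exp t)" by (simp add: EH)
      then show "exp s = exp t" using inj_onD[OF r2(4)] es that by simp
    qed (simp add: E_def)
    show "poly P (E s) = exp (- of_nat n * s)" if "Re s < c" for s
    proof -
      have "exp s ^ n * poly P (E s) = 1"
        unfolding E_def using Pg[OF _ er[OF that]] by simp
      moreover have "exp (- of_nat n * s) = 1 / exp s ^ n"
        by (simp add: exp_minus inverse_eq_divide flip: exp_of_nat_mult)
      ultimately show ?thesis by (metis inverse_unique inverse_eq_divide)
    qed
    show "z \<in> E ` {s. Re s < c}" if z: "exp (- real n * c) < norm (poly P z)" for z
    proof -
      have "1 / \<delta> < norm z" using M[of z] M1 c2 z by linarith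
      moreover from this have zn: "z \<noteq> 0" using \<delta>(1) by (auto simp: field_simps)
      ultimately have "1 / z \<in> ball 0 \<delta>" using \<delta>(1) by (simp add: norm_divide field_simps)
      then obtain t where t: "norm t < r2" "1 / z = H t" using \<delta>(2) by auto
      then have t0: "t \<noteq> 0" using zn by (auto simp: H_def)
      define s where "s = Ln t"
      have s: "exp s = t" using t0 by (simp add: s_def)
      have zE: "z = E s" using t(2) EH[of s] s zn by (simp add: field_simps)
      have "t ^ n * poly P z = 1"
        unfolding zE E_def s using Pg[OF t0 hne(2)[OF r21[OF t(1)]]] by simp
      then have "norm (poly P z) = exp (- real n * Re s)"
        by (metis (no_types, lifting) exp_minus exp_of_nat_mult inverse_unique mult_minus_left norm_exp_eq_Re norm_inverse norm_power s)
      then have "real n * Re s < real n * c" using z by simp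
      then show ?thesis using zE n(2) by auto
    qed
    show "\<exists>\<sigma>. Re \<sigma> = - ln (norm q) / n \<and> (\<forall>k<n. f k q = E (\<sigma> + 2 * of_real pi * \<i> * of_nat k / of_nat n))"
      if q: "q \<in> V" "exp (- real n * c) < norm q" for q
    proof (intro exI conjI allI impI)
      define \<sigma> where "\<sigma> = Ln (1 / \<rho> q)"
      have \<sigma>: "exp \<sigma> = 1 / \<rho> q" using \<rho>0[OF q(1)] by (simp add: \<sigma>_def)
      have "Re \<sigma> = - ln (norm (\<rho> q))" using \<rho>0[OF q(1)] by (simp add: \<sigma>_def norm_divide ln_div)
      moreover have "ln (norm q) = n * ln (norm (\<rho> q))"
        using norm\<rho>[OF q(1)] \<rho>0[OF q(1)] by (metis ln_realpow zero_less_norm_iff)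
      ultimately show "Re \<sigma> = - ln (norm q) / n" using n(2) by simp
      fix k assume k: "k < n"
      have "exp (\<sigma> + 2 * of_real pi * \<i> * of_nat k / of_nat n) = \<omega> ^ k / \<rho> q"
        by (simp add: exp_add \<sigma> \<omega>_def root_of_unity_power)
      then show "f k q = E (\<sigma> + 2 * of_real pi * \<i> * of_nat k / of_nat n)"
        unfolding E_def using h_eq[OF k q(1)] \<rho>0[OF q(1)] \<omega>0 by simp
    qed
  qed
qed

subsection \<open>Continua formed by lifts\<close>

text \<open>Another common point would be strictly nearer to \<open>c\<close>. Hence a segment drawn
  to a nearest point is attached to \<open>K\<close> at that point only.\<close>

lemma segment_to_nearest_point:
  fixes c p :: "'a::euclidean_space"
  assumes "p \<in> K" "\<And>w. w \<in> K \<Longrightarrow> dist c p \<le> dist c w"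
  shows "closed_segment c p \<inter> K = {p}"
proof
  show "closed_segment c p \<inter> K \<subseteq> {p}"
  proof
    fix x assume x: "x \<in> closed_segment c p \<inter> K"
    then have "dist c p = dist c x + dist x p" using between between_mem_segment by blast
    then show "x \<in> {p}" using assms(2)[of x] x by (simp add: add_decreasing2)
  qed
qed (use assms(1) in simp)

text \<open>The numeration enters only through the last assumption, which reads \<open>f k q\<close>
  at far points of \<open>V\<close> as the value of \<open>E\<close> at the \<open>k\<close>-th
  translate of \<open>\<sigma>\<close>. The Puiseux series no longer appears.\<close>

locale uniformized_branches =
  fixes P :: "complex poly" and n :: nat and U :: "complex set" and f :: "nat \<Rightarrow> complex \<Rightarrow> complex"
    and V :: "complex set" and E :: "complex \<Rightarrow> complex" and c :: real
  assumes degree: "degree P = n" "n > 0"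
    and U: "open U" "connected U" "U \<inter> critical_values P = {}"
    and branch: "\<And>j. j < n \<Longrightarrow> inverse_branch P U (f j)"
    and V: "open V" "connected V" "V \<subseteq> U" "\<not> bounded V"
    and E: "E holomorphic_on {s. Re s < c}"
      "\<And>s t. Re s < c \<Longrightarrow> Re t < c \<Longrightarrow> E s = E t \<longleftrightarrow> exp s = exp t"
      "\<And>s. Re s < c \<Longrightarrow> poly P (E s) = exp (- of_nat n * s)"
      "\<And>z. exp (- real n * c) < norm (poly P z) \<Longrightarrow> z \<in> E ` {s. Re s < c}"
      "\<And>q. q \<in> V \<Longrightarrow> exp (- real n * c) < norm q \<Longrightarrow>
         \<exists>\<sigma>. Re \<sigma> = - ln (norm q) / n \<and>
             (\<forall>k<n. f k q = E (\<sigma> + 2 * of_real pi * \<i> * of_nat k / of_nat n))"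
begin

lemma poly_branch: "j < n \<Longrightarrow> w \<in> U \<Longrightarrow> poly P (f j w) = w"
  using branch by (auto simp: inverse_branch_def)

lemma continuous_on_branch: "j < n \<Longrightarrow> S \<subseteq> U \<Longrightarrow> continuous_on S (f j)"
  using branch holomorphic_on_imp_continuous_on continuous_on_subset
  unfolding inverse_branch_def by blast

lemma far_point_in_V: obtains q where "q \<in> V" "r < norm q"
  using V(4) unfolding bounded_iff by (meson not_le)

lemma neg_ln_norm_less:
  assumes "exp (- real n * c) < x" shows "- ln x / n < c"
proof -
  have "x > 0" using assms by (meson exp_gt_zero less_trans)
  then have "- real n * c < ln x" using assms ln_less_cancel_iff[of "exp (- real n * c)" x] by simp
  then show ?thesis using degree(2) by (simp add: field_simps)
qed

text \<open>Agreement at one point propagates to a far point of \<open>V\<close>. There the two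
  arguments of \<open>E\<close> differ by \<open>2 * pi * \<i> * (i - j) / n\<close>, while
  \<open>E\<close> identifies only points that differ by multiples of
  \<open>2 * pi * \<i>\<close>.\<close>

lemma branches_disjoint:
  assumes "i < n" "j < n" "w \<in> U" "f i w = f j w"
  shows "i = j"
proof -
  obtain q where q: "q \<in> V" "exp (- real n * c) < norm q" by (rule far_point_in_V)
  obtain \<sigma> where \<sigma>: "Re \<sigma> = - ln (norm q) / n"
    "\<And>k. k < n \<Longrightarrow> f k q = E (\<sigma> + 2 * of_real pi * \<i> * of_nat k / of_nat n)"
    using E(5)[OF q] by blast
  have "f i q = f j q"
    using inverse_branches_eq[OF U branch branch] assms q V(3) by blast
  moreover have "Re \<sigma> < c" using neg_ln_norm_less[OF q(2)] \<sigma>(1) by simp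
  ultimately have "exp (\<sigma> + 2 * of_real pi * \<i> * of_nat i / of_nat n) =
      exp (\<sigma> + 2 * of_real pi * \<i> * of_nat j / of_nat n)"
    using \<sigma>(2)[OF assms(1)] \<sigma>(2)[OF assms(2)] by (subst E(2)[symmetric]) auto
  then have "root_of_unity n ^ i = root_of_unity n ^ j"
    by (simp add: exp_add root_of_unity_power)
  then have "int i mod int n = int j mod int n"
    unfolding root_of_unity_power_eq_circle_point by (rule circle_point_eq_imp_mod_eq[OF degree(2)])
  then show ?thesis using assms by simp
qed

lemma disjoint_branch_images:
  assumes "i < n" "j < n" "i \<noteq> j" "K \<subseteq> U"
  shows "f i ` K \<inter> f j ` K = {}"
proof (rule ccontr)
  assume "f i ` K \<inter> f j ` K \<noteq> {}"
  then obtain x y where xy: "x \<in> K" "y \<in> K" "f i x = f j y" by blast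
  then have "x = y" using poly_branch assms by (metis subsetD)
  then show False using branches_disjoint assms xy by blast
qed

definition tends where
  "tends d j \<longleftrightarrow> j < n \<and> (f j \<longlongrightarrow> d) (at (poly P d) within U)"

text \<open>By the choice of \<open>p\<close> the segment from \<open>poly P d\<close> to
  \<open>p\<close> meets \<open>K\<close> only at \<open>p\<close>. \<open>L j\<close> is to prolong
  the lift of \<open>K\<close> by branch \<open>j\<close> up to \<open>d\<close>, and the last two
  clauses let prolonged lifts by different branches meet at most in \<open>d\<close>.\<close>

definition segment_lifts where
  "segment_lifts d e K p L \<longleftrightarrow> p \<in> K \<and> (\<forall>w\<in>K. dist (poly P d) p \<le> dist (poly P d) w) \<and>
     (\<forall>j. tends d j \<longrightarrow> compact (L j) \<and> connected (L j) \<and> d \<in> L j \<and> f j p \<in> L j \<and> L j \<subseteq> ball d e \<and>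
        poly P ` L j \<subseteq> closed_segment (poly P d) p) \<and>
     (\<forall>i j. tends d i \<longrightarrow> j < n \<longrightarrow> i \<noteq> j \<longrightarrow> L i \<inter> f j ` K = {}) \<and>
     (\<forall>i j. tends d i \<longrightarrow> tends d j \<longrightarrow> i \<noteq> j \<longrightarrow> L i \<inter> L j \<subseteq> {d})"

lemma segment_liftsD:
  assumes "segment_lifts d e K p L"
  shows "p \<in> K" "\<And>w. w \<in> K \<Longrightarrow> dist (poly P d) p \<le> dist (poly P d) w"
    "\<And>j. tends d j \<Longrightarrow> compact (L j) \<and> connected (L j) \<and> d \<in> L j \<and> f j p \<in> L j \<and> L j \<subseteq> ball d e \<and>
        poly P ` L j \<subseteq> closed_segment (poly P d) p"
    "\<And>i j. tends d i \<Longrightarrow> j < n \<Longrightarrow> i \<noteq> j \<Longrightarrow> L i \<inter> f j ` K = {}"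
    "\<And>i j. tends d i \<Longrightarrow> tends d j \<Longrightarrow> i \<noteq> j \<Longrightarrow> L i \<inter> L j \<subseteq> {d}"
  using assms by (simp_all add: segment_lifts_def)

text \<open>
  A boundary point of \<open>U\<close> need not be accessible from \<open>U\<close>.  A continuum in \<open>U\<close> that comes close to
  \<open>poly P d\<close> is therefore continued to \<open>poly P d\<close> by a straight segment from its nearest point \<open>p\<close>,
  which may leave \<open>U\<close>; the branches tending to \<open>d\<close> extend along it because \<open>poly P\<close> is locally a power.
\<close>
lemma segment_lifts_of_tending_branches:
  assumes bd: "Some (poly P d) \<in> sphere_boundary U" and "e > 0"
  obtains \<eta> where "\<eta> > 0"
    "\<And>K. compact K \<Longrightarrow> K \<subseteq> U \<Longrightarrow> (\<exists>w\<in>K. dist w (poly P d) < \<eta>) \<Longrightarrow>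
      \<exists>p L. segment_lifts d e K p L"
proof -
  let ?c = "poly P d"
  have cU: "?c \<notin> U" using finite_sphere_boundary[OF U(1) bd] by blast
  have dP: "degree P > 0" using degree by simp
  obtain \<delta> L where \<delta>: "\<delta> > 0"
    and L: "\<And>z. z \<in> ball d \<delta> \<Longrightarrow> compact (L z) \<and> connected (L z) \<and> d \<in> L z \<and> z \<in> L z \<and> L z \<subseteq> ball d e \<and>
        poly P ` L z \<subseteq> closed_segment ?c (poly P z)"
    and Linj: "\<And>z w. z \<in> ball d \<delta> \<Longrightarrow> z \<noteq> d \<Longrightarrow> w \<in> L z \<Longrightarrow> poly P w = poly P z \<Longrightarrow> w = z"
    and Ldisj: "\<And>z w. z \<in> ball d \<delta> \<Longrightarrow> w \<in> ball d \<delta> \<Longrightarrow> z \<noteq> d \<Longrightarrow> poly P z = poly P w \<Longrightarrow> z \<noteq> w \<Longrightarrow>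
        L z \<inter> L w \<subseteq> {d}"
  proof (rule local_segment_lifts[OF dP \<open>e > 0\<close>, of d], goal_cases)
    case (1 \<delta> L)
    show ?case by (rule 1(1)[OF 1(2-5)])
  qed
  have "\<forall>\<^sub>F w in at ?c within U. \<forall>j\<in>{j. tends d j}. f j w \<in> ball d \<delta>"
  proof (rule eventually_ball_finite)
    show "finite {j. tends d j}" by (rule finite_subset[of _ "{..<n}"]) (auto simp: tends_def)
    show "\<forall>j\<in>{j. tends d j}. \<forall>\<^sub>F w in at ?c within U. f j w \<in> ball d \<delta>"
      using \<delta> by (auto simp: tends_def dist_commute dest: tendstoD[of _ d _ \<delta>])
  qed
  \<comment> \<open>One \<open>\<eta>\<close> serves all tending branches because they are finitely
    many. As \<open>poly P d\<close> is not in \<open>U\<close>, the punctured neighbourhood loses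
    no point of \<open>U\<close>.\<close>
  then obtain \<eta> where \<eta>: "\<eta> > 0"
    "\<And>w j. w \<in> U \<Longrightarrow> dist w ?c < \<eta> \<Longrightarrow> tends d j \<Longrightarrow> f j w \<in> ball d \<delta>"
    unfolding eventually_at using cU by (metis mem_Collect_eq)
  show ?thesis
  proof (rule that[OF \<eta>(1)])
    fix K assume K: "compact K" "K \<subseteq> U" "\<exists>w\<in>K. dist w ?c < \<eta>"
    then obtain p where p: "p \<in> K" "\<And>w. w \<in> K \<Longrightarrow> dist ?c p \<le> dist ?c w"
      using distance_attains_inf[of K ?c] by (metis compact_imp_closed empty_iff)
    have pU: "p \<in> U" using p K by blast
    have "dist p ?c < \<eta>" using K(3) p(2) by (metis dist_commute le_less_trans)
    then have near: "f j p \<in> ball d \<delta>" if "tends d j" for j using \<eta>(2)[OF pU] that by blast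
    have lt: "j < n" if "tends d j" for j using that by (simp add: tends_def)
    have inv: "poly P (f j p) = p" if "j < n" for j using poly_branch[OF that pU] .
    have ne: "f j p \<noteq> d" if "j < n" for j using inv[OF that] pU cU by auto
    \<comment> \<open>A common point lies over both the segment and \<open>K\<close>, hence over
      \<open>p\<close>; but \<open>L (f j p)\<close> has only one point over
      \<open>p\<close>.\<close>
    have one: "L (f j p) \<inter> f k ` K = {}" if jk: "tends d j" "k < n" "j \<noteq> k" for j k
    proof (rule ccontr)
      assume "\<not> ?thesis"
      then obtain w where w: "w \<in> K" "f k w \<in> L (f j p)" by blast
      have Pw: "poly P (f k w) = w" using poly_branch[OF jk(2)] w K by blast
      have "w \<in> closed_segment ?c p"
        using L[OF near[OF jk(1)]] w(2) Pw inv[OF lt[OF jk(1)]] by force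
      then have "w = p" using segment_to_nearest_point[OF p] w(1) by blast
      then have "f k p = f j p"
        using Linj[OF near[OF jk(1)] ne[OF lt[OF jk(1)]], of "f k p"] w(2) inv jk lt by metis
      then show False using branches_disjoint[OF jk(2) lt[OF jk(1)] pU] jk(3) by blast
    qed
    have two: "L (f i p) \<inter> L (f j p) \<subseteq> {d}" if ij: "tends d i" "tends d j" "i \<noteq> j" for i j
    proof (rule Ldisj[OF near[OF ij(1)] near[OF ij(2)] ne[OF lt[OF ij(1)]]])
      show "poly P (f i p) = poly P (f j p)" using inv lt ij by metis
      show "f i p \<noteq> f j p" using branches_disjoint[OF lt[OF ij(1)] lt[OF ij(2)] pU] ij(3) by blast
    qed
    have "segment_lifts d e K p (\<lambda>j. L (f j p))"
      unfolding segment_lifts_def using p one two L[OF near] inv lt by simp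
    then show "\<exists>p L. segment_lifts d e K p L" by blast
  qed
qed

section \<open>Branches tending to both points\<close>

lemma approach_boundary_point:
  assumes "Some w \<in> sphere_boundary U" "\<eta> > 0"
  obtains u where "u \<in> U" "dist u w < \<eta>"
  using finite_sphere_boundary(1)[OF U(1) assms(1)] assms(2) unfolding closure_approachable by blast

lemma tends_unique:
  assumes "tends a j" "tends b j" "poly P a = poly P b" "Some (poly P a) \<in> sphere_boundary U"
  shows "a = b"
proof -
  have "at (poly P a) within U \<noteq> bot"
    using finite_sphere_boundary[OF U(1) assms(4)]
    by (auto simp: trivial_limit_within islimpt_in_closure)
  then show ?thesis
    using assms tendsto_unique unfolding tends_def by metis
qed

text \<open>
  Two common branches would lift an arc from \<open>poly P a\<close> to \<open>poly P b\<close> to two continua meeting in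
  \<open>{a, b}\<close>, so their union would separate the plane, although \<open>poly P\<close> maps it into an arc.
\<close>
lemma at_most_one_common_branch:
  assumes ab: "a \<noteq> b" "Some (poly P a) \<in> sphere_boundary U" "Some (poly P b) \<in> sphere_boundary U"
    and i: "tends a i" "tends b i" and j: "tends a j" "tends b j"
  shows "i = j"
proof (rule ccontr)
  assume ij: "i \<noteq> j"
  have lt: "i < n" "j < n" using i j by (auto simp: tends_def)
  \<comment> \<open>Half distances make the balls containing the lifted segments disjoint in the
    source, and the segments themselves disjoint in the target.\<close>
  define e D where "e = dist a b / 2" and "D = dist (poly P a) (poly P b) / 2"
  have e: "e > 0" using ab by (simp add: e_def)
  have D: "D > 0" using tends_unique[OF i] ab by (auto simp: D_def)
  obtain \<eta>a where \<eta>a: "\<eta>a > 0" "\<And>K. compact K \<Longrightarrow> K \<subseteq> U \<Longrightarrow> (\<exists>w\<in>K. dist w (poly P a) < \<eta>a) \<Longrightarrow>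
      \<exists>p L. segment_lifts a e K p L"
    by (rule segment_lifts_of_tending_branches[OF ab(2) e]) (rule that; blast)
  obtain \<eta>b where \<eta>b: "\<eta>b > 0" "\<And>K. compact K \<Longrightarrow> K \<subseteq> U \<Longrightarrow> (\<exists>w\<in>K. dist w (poly P b) < \<eta>b) \<Longrightarrow>
      \<exists>p L. segment_lifts b e K p L"
    by (rule segment_lifts_of_tending_branches[OF ab(3) e]) (rule that; blast)
  obtain wa where wa: "wa \<in> U" "dist wa (poly P a) < min \<eta>a D"
    using approach_boundary_point[OF ab(2), of "min \<eta>a D"] \<eta>a(1) D by auto
  obtain wb where wb: "wb \<in> U" "dist wb (poly P b) < min \<eta>b D"
    using approach_boundary_point[OF ab(3), of "min \<eta>b D"] \<eta>b(1) D by auto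
  have far: "x \<noteq> y" if "dist x (poly P a) < D" "dist y (poly P b) < D" for x y
  proof
    assume "x = y"
    have "2 * D \<le> dist x (poly P a) + dist x (poly P b)"
      unfolding D_def using dist_triangle3[of "poly P a" "poly P b" x] by simp
    then show False using that \<open>x = y\<close> by simp
  qed
  obtain g0 where g0: "path g0" "path_image g0 \<subseteq> U" "pathstart g0 = wa" "pathfinish g0 = wb"
    using connected_open_path_connected[OF U(1,2)] wa wb unfolding path_connected_def by blast
  \<comment> \<open>An arc, unlike a general path, has connected complement and empty
    interior.\<close>
  obtain g where g: "arc g" "path_image g \<subseteq> path_image g0" "pathstart g = wa" "pathfinish g = wb"
    using path_contains_arc[OF g0(1,3,4)] far[of wa wb] wa wb by auto
  define K where "K = path_image g"
  have K: "compact K" "connected K" "K \<subseteq> U" "wa \<in> K" "wb \<in> K"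
    using g g0 by (auto simp: K_def compact_arc_image connected_arc_image)
  obtain pa La where "segment_lifts a e K pa La" using \<eta>a(2)[OF K(1,3)] K(4) wa(2) by auto
  note pa = segment_liftsD(1,2)[OF this] and La = segment_liftsD(3-5)[OF this]
  obtain pb Lb where "segment_lifts b e K pb Lb" using \<eta>b(2)[OF K(1,3)] K(5) wb(2) by auto
  note pb = segment_liftsD(1,2)[OF this] and Lb = segment_liftsD(3-5)[OF this]
  define sa sb where "sa = closed_segment (poly P a) pa" and "sb = closed_segment (poly P b) pb"
  have sa: "dist x (poly P a) < D" if "x \<in> sa" for x
  proof -
    have "dist (poly P a) x \<le> dist (poly P a) pa"
      using that dist_in_closed_segment[of x "poly P a" pa] by (simp add: sa_def dist_commute)
    then show ?thesis using pa(2)[OF K(4)] wa(2) by (simp add: dist_commute)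
  qed
  have sb: "dist x (poly P b) < D" if "x \<in> sb" for x
  proof -
    have "dist (poly P b) x \<le> dist (poly P b) pb"
      using that dist_in_closed_segment[of x "poly P b" pb] by (simp add: sb_def dist_commute)
    then show ?thesis using pb(2)[OF K(5)] wb(2) by (simp add: dist_commute)
  qed
  have sasb: "sa \<inter> sb = {}" using far sa sb by blast
  have saK: "K \<inter> sa = {pa}" using segment_to_nearest_point[OF pa] by (auto simp: sa_def)
  have sbK: "(K \<union> sa) \<inter> sb = {pb}"
    using segment_to_nearest_point[OF pb] sasb by (auto simp: sb_def)
  have seg: "compact s \<and> connected (- s) \<and> interior s = {}" if "s = closed_segment x y" for s and x y :: complex
    using that by (auto simp: interior_closed_segment_ge2 compact_imp_bounded intro!: connected_complement_bounded_convex)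
  \<comment> \<open>Each segment meets what is already built in one point, so by Janiszewski's
    theorem the complement remains connected.\<close>
  have "connected (- K)" unfolding K_def using g(1) by (intro connected_arc_complement) auto
  then have 1: "connected (- (K \<union> sa))"
    using Janiszewski_connected[of K sa] K(1) saK seg[OF sa_def] by (auto simp: compact_imp_closed)
  have conC: "connected (- (K \<union> sa \<union> sb))"
    using Janiszewski_connected[of "K \<union> sa" sb] 1 K(1) sbK seg[OF sa_def] seg[OF sb_def]
    by (auto simp: compact_imp_closed)
  have "interior K = {}" unfolding K_def using interior_arc_image[OF g(1)] .
  then have int: "interior (K \<union> sa \<union> sb) = {}"
    using seg[OF sa_def] seg[OF sb_def] K(1) interior_closed_Un_empty_interior
    by (metis closed_Un compact_imp_closed)
  define A where "A k = f k ` K \<union> La k \<union> Lb k" for k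
  have A: "compact (A k) \<and> connected (A k) \<and> a \<in> A k \<and> b \<in> A k \<and> poly P ` A k \<subseteq> K \<union> sa \<union> sb"
    if k: "tends a k" "tends b k" for k
  proof -
    have kn: "k < n" using k by (simp add: tends_def)
    have fK: "compact (f k ` K)" "connected (f k ` K)"
      using K continuous_on_branch[OF kn K(3)]
      by (auto intro: compact_continuous_image connected_continuous_image)
    have "connected (f k ` K \<union> La k)" using La(1)[OF k(1)] fK pa(1) by (intro connected_Un) auto
    then have "connected (A k)" unfolding A_def using Lb(1)[OF k(2)] pb(1)
      by (intro connected_Un[of "f k ` K \<union> La k"]) auto
    moreover have "poly P ` f k ` K \<subseteq> K" using poly_branch[OF kn] K(3) by auto
    ultimately show ?thesis
      using La(1)[OF k(1)] Lb(1)[OF k(2)] fK(1) by (auto simp: A_def sa_def sb_def)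
  qed
  have balls: "ball a e \<inter> ball b e = {}" unfolding e_def by (rule disjoint_ballI) simp
  have La_ball: "La k \<subseteq> ball a e" if "tends a k" for k using La(1)[OF that] by simp
  have Lb_ball: "Lb k \<subseteq> ball b e" if "tends b k" for k using Lb(1)[OF that] by simp
  have union_Int: "(X \<union> Y \<union> Z) \<inter> (X' \<union> Y' \<union> Z') \<subseteq> {a, b}"
    if "Y \<inter> Z' = {}" "Z \<inter> Y' = {}" "Y \<inter> X' = {}" "Y' \<inter> X = {}" "Y \<inter> Y' \<subseteq> {a}"
      "Z \<inter> X' = {}" "Z' \<inter> X = {}" "Z \<inter> Z' \<subseteq> {b}" "X \<inter> X' = {}" for X Y Z X' Y' Z'
    using that by blast
  have "A i \<inter> A j = {a, b}"
  proof
    have "La i \<inter> Lb j = {}" "Lb i \<inter> La j = {}"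
      using balls La_ball[OF i(1)] La_ball[OF j(1)] Lb_ball[OF i(2)] Lb_ball[OF j(2)] by blast+
    moreover have "La i \<inter> f j ` K = {}" "La j \<inter> f i ` K = {}" "La i \<inter> La j \<subseteq> {a}"
      using La(2)[OF i(1) lt(2) ij] La(2)[OF j(1) lt(1)] La(3)[OF i(1) j(1) ij] ij by blast+
    moreover have "Lb i \<inter> f j ` K = {}" "Lb j \<inter> f i ` K = {}" "Lb i \<inter> Lb j \<subseteq> {b}"
      using Lb(2)[OF i(2) lt(2) ij] Lb(2)[OF j(2) lt(1)] Lb(3)[OF i(2) j(2) ij] ij by blast+
    moreover have "f i ` K \<inter> f j ` K = {}" using disjoint_branch_images[OF lt ij K(3)] .
    ultimately show "A i \<inter> A j \<subseteq> {a, b}" unfolding A_def by (rule union_Int)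
  qed (use A[OF i] A[OF j] in blast)
  \<comment> \<open>By the dual of Janiszewski's theorem, two continua whose union does not separate
    the plane have connected intersection; \<open>{a, b}\<close> is not connected.\<close>
  moreover have "connected (- (A i \<union> A j))"
  proof (rule connected_Compl_over_thin_set[OF _ conC int])
    show "compact (K \<union> sa \<union> sb)" using K(1) seg[OF sa_def] seg[OF sb_def] by auto
    show "compact (A i \<union> A j)" using A[OF i] A[OF j] by auto
    show "poly P ` (A i \<union> A j) \<subseteq> K \<union> sa \<union> sb" using A[OF i] A[OF j] by blast
  qed (simp add: degree)
  then have "connected (A i \<inter> A j)" using A[OF i] A[OF j] by (intro Janiszewski_dual) auto
  ultimately have "connected {a, b}" by simp
  then show False using connected_finite_iff_sing[of "{a, b}"] ab(1) by auto
qed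

section \<open>Cyclic order of the tending branches\<close>

lemma large_fiber_image:
  assumes "exp (- real n * c) < R"
  shows "- {z. norm (poly P z) \<le> R} = E ` {s. Re s < - ln R / n}"
proof
  have R: "R > 0" using assms by (meson exp_gt_zero less_trans)
  have norm_E: "norm (poly P (E s)) = exp (- real n * Re s)" if "Re s < c" for s
    using E(3)[OF that] by simp
  have iff: "R < exp (- real n * x) \<longleftrightarrow> x < - ln R / n" for x
  proof -
    have "R < exp (- real n * x) \<longleftrightarrow> ln R < - real n * x" using R by (metis exp_less_cancel_iff exp_ln)
    also have "\<dots> \<longleftrightarrow> x < - ln R / n" using degree(2) by (auto simp: field_simps)
    finally show ?thesis .
  qed
  show "- {z. norm (poly P z) \<le> R} \<subseteq> E ` {s. Re s < - ln R / n}"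
  proof
    fix z assume "z \<in> - {z. norm (poly P z) \<le> R}"
    then have z: "R < norm (poly P z)" by simp
    then obtain s where s: "Re s < c" "z = E s" using E(4)[of z] assms by auto
    then have "Re s < - ln R / n" using z norm_E[OF s(1)] iff by simp
    then show "z \<in> E ` {s. Re s < - ln R / n}" using s(2) by blast
  qed
  show "E ` {s. Re s < - ln R / n} \<subseteq> - {z. norm (poly P z) \<le> R}"
  proof clarify
    fix s assume s: "Re s < - ln R / n" "norm (poly P (E s)) \<le> R"
    then have "Re s < c" using neg_ln_norm_less[OF assms] by linarith
    then show False using norm_E[of s] iff[of "Re s"] s by auto
  qed
qed

text \<open>The two prolonged lifts tending to \<open>a\<close> share \<open>a\<close> and form one
  continuum; those tending to \<open>b\<close> share \<open>b\<close>. An interlacing of indices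
  would make these two disjoint continua reach the boundary of \<open>T\<close> at interlaced
  arguments.\<close>

lemma tending_branches_noncrossing:
  assumes ab: "a \<noteq> b" "Some (poly P a) \<in> sphere_boundary U" "Some (poly P b) \<in> sphere_boundary U"
  shows "noncrossing n (\<lambda>k. tends a (nat (k mod int n))) (\<lambda>k. tends b (nat (k mod int n)))"
  unfolding noncrossing_def
proof safe
  define m where "m k = nat (k mod int n)" for k
  fix i1 j1 i2 j2
  assume "tends a (nat (i1 mod int n))" "tends b (nat (j1 mod int n))"
    "tends a (nat (i2 mod int n))" "tends b (nat (j2 mod int n))"
  then have t: "tends a (m i1)" "tends b (m j1)" "tends a (m i2)" "tends b (m j2)"
    by (simp_all add: m_def)
  assume ord: "i1 < j1" "j1 < i2" "i2 < j2" "j2 < i1 + int n"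
  have lt: "m i1 < n" "m j1 < n" "m i2 < n" "m j2 < n" using t by (simp_all add: tends_def)
  have mne: "m k \<noteq> m l" if "k < l" "l < k + int n" for k l
  proof
    assume "m k = m l"
    then have "k mod int n = l mod int n"
      using degree(2) by (simp add: m_def eq_nat_nat_iff)
    then have "(l - k) mod int n = 0" by (metis mod_eq_dvd_iff dvd_imp_mod_0)
    then show False using that by simp
  qed
  have ne: "m i1 \<noteq> m j1" "m i1 \<noteq> m j2" "m i2 \<noteq> m j1" "m i2 \<noteq> m j2"
    using mne[of i1 j1] mne[of i1 j2] mne[of j1 i2] mne[of i2 j2] ord by auto
  define e where "e = dist a b / 2"
  have e: "e > 0" using ab by (simp add: e_def)
  obtain \<eta>a where \<eta>a: "\<eta>a > 0" "\<And>K. compact K \<Longrightarrow> K \<subseteq> U \<Longrightarrow> (\<exists>w\<in>K. dist w (poly P a) < \<eta>a) \<Longrightarrow>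
      \<exists>p L. segment_lifts a e K p L"
    by (rule segment_lifts_of_tending_branches[OF ab(2) e]) (rule that; blast)
  obtain \<eta>b where \<eta>b: "\<eta>b > 0" "\<And>K. compact K \<Longrightarrow> K \<subseteq> U \<Longrightarrow> (\<exists>w\<in>K. dist w (poly P b) < \<eta>b) \<Longrightarrow>
      \<exists>p L. segment_lifts b e K p L"
    by (rule segment_lifts_of_tending_branches[OF ab(3) e]) (rule that; blast)
  obtain wa where wa: "wa \<in> U" "dist wa (poly P a) < \<eta>a"
    using approach_boundary_point[OF ab(2) \<eta>a(1)] .
  obtain wb where wb: "wb \<in> U" "dist wb (poly P b) < \<eta>b"
    using approach_boundary_point[OF ab(3) \<eta>b(1)] .
  have V0: "V \<noteq> {}" using V(4) by auto
  then obtain v where v: "v \<in> V" by blast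
  have pcU: "\<exists>g. path g \<and> path_image g \<subseteq> U \<and> pathstart g = x \<and> pathfinish g = y" if "x \<in> U" "y \<in> U" for x y
    using connected_open_path_connected[OF U(1,2)] that unfolding path_connected_def by blast
  obtain g1 where g1: "path g1" "path_image g1 \<subseteq> U" "pathstart g1 = wa" "pathfinish g1 = v"
    using pcU[OF wa(1), of v] v V(3) by blast
  obtain g2 where g2: "path g2" "path_image g2 \<subseteq> U" "pathstart g2 = wb" "pathfinish g2 = v"
    using pcU[OF wb(1), of v] v V(3) by blast
  define K0 where "K0 = path_image g1 \<union> path_image g2"
  have "bounded (insert (poly P a) (insert (poly P b) K0))"
    unfolding K0_def using g1(1) g2(1)
    by (intro compact_imp_bounded compact_insert compact_Un compact_path_image)
  then obtain R0 where R0: "\<And>x. x \<in> insert (poly P a) (insert (poly P b) K0) \<Longrightarrow> norm x \<le> R0"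
    unfolding bounded_iff by blast
  \<comment> \<open>The point lies beyond \<open>K0\<close>, beyond both boundary values and in the
    range of the uniformization. Joining it to \<open>v\<close> inside \<open>V\<close> leaves only
    that last path free to contain points of modulus above \<open>R0\<close>.\<close>
  obtain q1 where q1: "q1 \<in> V" "max R0 (exp (- real n * c)) < norm q1" by (rule far_point_in_V)
  obtain g3 where g3: "path g3" "path_image g3 \<subseteq> V" "pathstart g3 = v" "pathfinish g3 = q1"
    using connected_open_path_connected[OF V(1,2)] v q1(1) unfolding path_connected_def by blast
  define K where "K = path_image g1 \<union> path_image g2 \<union> path_image g3"
  have vg: "v \<in> path_image g1" "v \<in> path_image g2" "v \<in> path_image g3"
    using g1 g2 g3 pathstart_in_path_image pathfinish_in_path_image by metis+
  have "connected (path_image g1 \<union> path_image g2)"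
    using g1(1) g2(1) vg by (intro connected_Un connected_path_image) auto
  then have "connected K"
    unfolding K_def using g3(1) vg by (intro connected_Un[of "path_image g1 \<union> path_image g2"] connected_path_image) auto
  moreover have "compact K"
    unfolding K_def using g1(1) g2(1) g3(1) by (intro compact_Un compact_path_image)
  moreover have "K \<subseteq> U" using g1(2) g2(2) g3(2) V(3) by (auto simp: K_def)
  moreover have "wa \<in> K" "wb \<in> K" "q1 \<in> K"
    using g1 g2 g3 pathstart_in_path_image pathfinish_in_path_image unfolding K_def by blast+
  ultimately have K: "compact K" "connected K" "K \<subseteq> U" "wa \<in> K" "wb \<in> K" "q1 \<in> K" by simp_all
  \<comment> \<open>A point of \<open>K\<close> of maximal modulus lies on the part of \<open>K\<close> inside \<open>V\<close>, where the numeration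
     is given by the Puiseux series.\<close>
  obtain q where q: "q \<in> K" "\<And>w. w \<in> K \<Longrightarrow> norm w \<le> norm q"
    using continuous_attains_sup[of K norm] K(1,4) by (metis continuous_on_norm_id empty_iff)
  define R c0 where "R = norm q" and "c0 = - ln R / n"
  have R: "max R0 (exp (- real n * c)) < R" using q(2)[OF K(6)] q1(2) by (simp add: R_def)
  have qV: "q \<in> V"
  proof -
    have "q \<notin> K0" using R0[of q] R by (auto simp: R_def)
    then show ?thesis using q(1) g3(2) by (auto simp: K_def K0_def)
  qed
  define T where "T = {z. norm (poly P z) \<le> R}"
  obtain pa La where "segment_lifts a e K pa La" using \<eta>a(2)[OF K(1,3)] K(4) wa(2) by auto
  note pa = segment_liftsD(1,2)[OF this] and La = segment_liftsD(3-5)[OF this]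
  obtain pb Lb where "segment_lifts b e K pb Lb" using \<eta>b(2)[OF K(1,3)] K(5) wb(2) by auto
  note pb = segment_liftsD(1,2)[OF this] and Lb = segment_liftsD(3-5)[OF this]
  \<comment> \<open>The prolongation stays in \<open>T\<close> because the segment below it has both
    ends in the convex disc \<open>cball 0 R\<close>.\<close>
  have arm: "compact (f k ` K \<union> L k) \<and> connected (f k ` K \<union> L k) \<and> d \<in> f k ` K \<union> L k \<and>
      f k q \<in> f k ` K \<union> L k \<and> f k ` K \<union> L k \<subseteq> T"
    if k: "tends d k" "p \<in> K" "norm (poly P d) \<le> R" "compact (L k) \<and> connected (L k) \<and> d \<in> L k \<and>
      f k p \<in> L k \<and> L k \<subseteq> ball d e \<and> poly P ` L k \<subseteq> closed_segment (poly P d) p" for d k p L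
  proof -
    have kn: "k < n" using k(1) by (simp add: tends_def)
    have "compact (f k ` K)" "connected (f k ` K)"
      using K continuous_on_branch[OF kn K(3)]
      by (auto intro: compact_continuous_image connected_continuous_image)
    moreover from this have "connected (f k ` K \<union> L k)" using k by (intro connected_Un) auto
    moreover have "f k ` K \<subseteq> T"
      unfolding T_def R_def using poly_branch[OF kn] K(3) q(2) by auto
    moreover have "closed_segment (poly P d) p \<subseteq> cball 0 R"
      using k(2,3) q(2) by (intro closed_segment_subset) (auto simp: R_def)
    then have "poly P ` L k \<subseteq> cball 0 R" using k(4) by (meson subset_trans)
    then have "L k \<subseteq> T" by (simp add: T_def image_subset_iff subset_iff)
    ultimately show ?thesis using k q(1) by blast
  qed
  have "norm (poly P a) \<le> R" "norm (poly P b) \<le> R" using R0[of "poly P a"] R0[of "poly P b"] R by auto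
  note armA = arm[where d = a and L = La, OF _ pa(1) this(1) La(1)]
    and armB = arm[where d = b and L = Lb, OF _ pb(1) this(2) Lb(1)]
  define A B where "A = (f (m i1) ` K \<union> La (m i1)) \<union> (f (m i2) ` K \<union> La (m i2))"
    and "B = (f (m j1) ` K \<union> Lb (m j1)) \<union> (f (m j2) ` K \<union> Lb (m j2))"
  have A: "compact A" "connected A" "A \<subseteq> T"
    unfolding A_def using armA[OF t(1) t(1)] armA[OF t(3) t(3)] by (blast intro: compact_Un connected_Un)+
  have B: "connected B" "B \<subseteq> T"
    unfolding B_def using armB[OF t(2) t(2)] armB[OF t(4) t(4)] by (blast intro: connected_Un)+
  have balls: "ball a e \<inter> ball b e = {}" unfolding e_def by (rule disjoint_ballI) simp
  have dj: "(f i ` K \<union> La i) \<inter> (f j ` K \<union> Lb j) = {}" if ij: "tends a i" "tends b j" "i \<noteq> j" for i j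
  proof -
    have l: "i < n" "j < n" using ij by (simp_all add: tends_def)
    have "La i \<inter> Lb j = {}" using balls La(1)[OF ij(1)] Lb(1)[OF ij(2)] by blast
    moreover have "La i \<inter> f j ` K = {}" "Lb j \<inter> f i ` K = {}"
      using La(2)[OF ij(1) l(2)] Lb(2)[OF ij(2) l(1)] ij(3) by blast+
    moreover have "f i ` K \<inter> f j ` K = {}" using disjoint_branch_images[OF l ij(3) K(3)] .
    ultimately show ?thesis by blast
  qed
  have AB: "A \<inter> B = {}"
  proof -
    have "(X \<union> X') \<inter> (Y \<union> Y') = {}"
      if "X \<inter> Y = {}" "X \<inter> Y' = {}" "X' \<inter> Y = {}" "X' \<inter> Y' = {}" for X X' Y Y' :: "complex set"
      using that by blast
    then show ?thesis unfolding A_def B_def by (metis dj t ne)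
  qed
  have Rc: "exp (- real n * c) < R" using R by simp
  obtain \<sigma> where \<sigma>: "Re \<sigma> = c0"
    "\<And>k. k < n \<Longrightarrow> f k q = E (\<sigma> + 2 * of_real pi * \<i> * of_nat k / of_nat n)"
    using E(5)[OF qV] Rc unfolding c0_def R_def by blast
  have c0c: "c0 < c" using neg_ln_norm_less[OF Rc] by (simp add: c0_def)
  \<comment> \<open>\<open>\<theta>\<close> is defined on all integers, so that a shift by one
    period is a full turn and indices need no reduction.\<close>
  define \<theta> where "\<theta> k = Im \<sigma> + 2 * pi * real_of_int k / n" for k
  have fq: "f (m k) q = E (Complex c0 (\<theta> k))" if "m k < n" for k
  proof -
    have "circle_point n (of_int (int (m k))) = circle_point n (of_int k)"
      using circle_point_int_mod[OF degree(2), of k] degree(2) by (simp add: m_def)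
    then have "exp (2 * of_real pi * \<i> * of_nat (m k) / of_nat n) = exp (\<i> * of_real (2 * pi * of_int k / n))"
      by (simp add: circle_point_def cis_conv_exp mult_ac)
    moreover have "Complex c0 (\<theta> k) = \<sigma> + \<i> * of_real (2 * pi * of_int k / n)"
      using \<sigma>(1) by (simp add: \<theta>_def complex_eq_iff)
    ultimately have "exp (\<sigma> + 2 * of_real pi * \<i> * of_nat (m k) / of_nat n) = exp (Complex c0 (\<theta> k))"
      by (simp add: exp_add)
    moreover have "Re (\<sigma> + 2 * of_real pi * \<i> * of_nat (m k) / of_nat n) < c"
      using \<sigma>(1) c0c by simp
    ultimately show ?thesis
      using \<sigma>(2)[OF that] c0c E(2)[of "\<sigma> + 2 * of_real pi * \<i> * of_nat (m k) / of_nat n" "Complex c0 (\<theta> k)"]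
      by simp
  qed
  have \<theta>less: "\<theta> k < \<theta> l" if "k < l" for k l
    using that degree(2) by (simp add: \<theta>_def divide_strict_right_mono)
  have "\<theta> (i1 + int n) = \<theta> i1 + 2 * pi" using degree(2) by (simp add: \<theta>_def field_simps)
  then have \<theta>end: "\<theta> j2 < \<theta> i1 + 2 * pi" using \<theta>less[OF ord(4)] by simp
  show False
  proof (rule no_crossing_continua[OF E(1) c0c E(2), of T A B "\<theta> i1" "\<theta> i2" "\<theta> j1" "\<theta> j2"])
    show "closed T" unfolding T_def by (intro closed_Collect_le continuous_intros)
    show "- T = E ` {s. Re s < c0}" unfolding T_def c0_def by (rule large_fiber_image[OF Rc])
    show "E (Complex c0 (\<theta> i1)) \<in> A" "E (Complex c0 (\<theta> i2)) \<in> A"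
      using armA[OF t(1) t(1)] armA[OF t(3) t(3)] fq lt unfolding A_def by auto
    show "E (Complex c0 (\<theta> j1)) \<in> B" "E (Complex c0 (\<theta> j2)) \<in> B"
      using armB[OF t(2) t(2)] armB[OF t(4) t(4)] fq lt unfolding B_def by auto
  qed (use A B AB \<theta>less ord \<theta>end in auto)
qed

section \<open>Translation into sets of roots of unity\<close>

lemma branch_roots_eq:
  "branch_roots P U f d = circle_point n ` of_int ` {k. tends d (nat (k mod int n))}"
proof
  note root = root_of_unity_power_eq_circle_point
  show "branch_roots P U f d \<subseteq> circle_point n ` of_int ` {k. tends d (nat (k mod int n))}"
  proof
    fix z assume "z \<in> branch_roots P U f d"
    then obtain j where j: "tends d j" "z = circle_point n (of_int (int j))"
      unfolding branch_roots_def tends_def degree(1) root by blast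
    then have "int j \<in> {k. tends d (nat (k mod int n))}" by (simp add: tends_def)
    then show "z \<in> circle_point n ` of_int ` {k. tends d (nat (k mod int n))}"
      unfolding j(2) by (intro imageI)
  qed
  show "circle_point n ` of_int ` {k. tends d (nat (k mod int n))} \<subseteq> branch_roots P U f d"
  proof clarify
    fix k assume "tends d (nat (k mod int n))"
    moreover have "circle_point n (of_int k) = root_of_unity n ^ nat (k mod int n)"
      unfolding root using circle_point_int_mod[OF degree(2), of k] degree(2) by simp
    ultimately show "circle_point n (of_int k) \<in> branch_roots P U f d"
      unfolding branch_roots_def tends_def degree(1) by auto
  qed
qed

lemma branch_roots_circle_disjointed:
  assumes ab: "a \<noteq> b" "Some (poly P a) \<in> sphere_boundary U" "Some (poly P b) \<in> sphere_boundary U"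
  shows "(circle_disjointed (branch_roots P U f a) (branch_roots P U f b) \<or>
          circle_almost_disjointed (branch_roots P U f a) (branch_roots P U f b)) \<and>
         (poly P a = poly P b \<longrightarrow>
          circle_disjointed (branch_roots P U f a) (branch_roots P U f b))"
proof -
  let ?A = "\<lambda>k. tends a (nat (k mod int n))" and ?B = "\<lambda>k. tends b (nat (k mod int n))"
  have per: "mod_periodic n ?A" "mod_periodic n ?B" by (simp_all add: mod_periodic_def)
  note nc = tending_branches_noncrossing[OF ab]
  show ?thesis
  proof (cases "\<exists>s. ?A s \<and> ?B s")
    case False
    then have "circle_disjointed (branch_roots P U f a) (branch_roots P U f b)"
      unfolding branch_roots_eq
      by (intro noncrossing_imp_circle_disjointed[OF degree(2) per nc]) blast
    then show ?thesis by blast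
  next
    case True
    then obtain s where s: "?A s" "?B s" by blast
    have "k mod int n = s mod int n" if "?A k" "?B k" for k
      using at_most_one_common_branch[OF ab that s] degree(2) by (simp add: eq_nat_nat_iff)
    then have "circle_almost_disjointed (branch_roots P U f a) (branch_roots P U f b)"
      unfolding branch_roots_eq
      by (intro noncrossing_imp_circle_almost_disjointed[OF degree(2) per nc s]) blast
    moreover have "poly P a \<noteq> poly P b" using tends_unique[OF s] ab by blast
    ultimately show ?thesis by blast
  qed
qed

end

text \<open>In degree 0 the root condition reads \<open>1 = z\<close> on \<open>V\<close>, so
  \<open>V\<close> could not approach infinity.\<close>

lemma canonical_numeration_imp_degree_pos:
  assumes "canonical_numeration P U f" shows "degree P > 0"
proof (rule ccontr)
  assume "\<not> degree P > 0"
  then obtain V where V: "None \<in> sphere_boundary V" "\<forall>z\<in>V. 1 = z"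
    using assms unfolding canonical_numeration_def by auto
  then have "V \<subseteq> {1}" by auto
  then have "finite V" by (rule finite_subset) simp
  then show False using infinite_sphere_boundary[OF V(1)] finite_imp_bounded by metis
qed

theorem mainTheorem5:
  fixes P :: "complex poly" and n :: nat and a b :: complex
    and U :: "complex set" and f :: "nat \<Rightarrow> complex \<Rightarrow> complex"
  assumes "degree P = n" and "a \<noteq> b"
    and "open U" and "connected U" and "simply_connected U"
    and "U \<inter> critical_values P = {}"
    and "Some (poly P a) \<in> sphere_boundary U"
    and "Some (poly P b) \<in> sphere_boundary U"
    and "None \<in> sphere_boundary U"
    and "canonical_numeration P U f"
  shows "(circle_disjointed (branch_roots P U f a) (branch_roots P U f b) \<or>
          circle_almost_disjointed (branch_roots P U f a) (branch_roots P U f b)) \<and>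
         (poly P a = poly P b \<longrightarrow>
          circle_disjointed (branch_roots P U f a) (branch_roots P U f b))"
proof -
  have n: "n > 0" using canonical_numeration_imp_degree_pos[OF assms(10)] assms(1) by simp
  have branch: "inverse_branch P U (f j)" if "j < n" for j
    using assms(10) that unfolding canonical_numeration_def assms(1) by blast
  obtain V E c where "uniformized_branches P n U f V E c"
  proof (rule canonical_numeration_uniformized[OF assms(1) n assms(10)], goal_cases)
    case (1 V E c)
    show ?case
      by (rule 1(1)[of V E c], unfold_locales) (use 1 assms n branch in blast)+
  qed
  then show ?thesis
    using uniformized_branches.branch_roots_circle_disjointed assms(2,7,8) by blast
qed

end
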